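(* Let $M$ be an almost complex manifold with almost complex structure $\varphi\in\Im^1_1(M)$ (so $\varphi^2=-I$), let $q\ge 1$, and let $\xi\in\Im^0_q(M)$ be an almost analytic tensor field (i.e. $\xi$ is pure with respect to $\varphi$ and $\Phi_\varphi\xi=0$). Then the complete lift ${}^C\varphi$ of $\varphi$ to the tensor bundle $T^0_q(M)$, when restricted to the pure cross-section $\sigma^\varphi_\xi(M)$ determined by $\xi$, is an almost complex structure; that is, $({}^C\varphi)^2=-I$ along $\sigma_\xi^\varphi(M)$, where $I$ is the identity on the tangent spaces of $T^0_q(M)$ at the points of $\sigma^\varphi_\xi(M)$.
   Context: All manifolds and tensor fields are $C^\infty$; $M$ has finite dimension $n$; $\Im^p_q(M)$ denotes the set of tensor fields of type $(p,q)$ on $M$; the Einstein summation convention is used. $\pi:T^0_q(M)\to M$ is the bundle of $(0,q)$-tensors, a manifold of dimension $n+n^q$. Local coordinates $x^j$ on $U\subset M$ induce local coordinates $(x^j,x^{\bar j})=(x^j,t_{j_1\cdots j_q})$ on $\pi^{-1}(U)$, where $t_{j_1\cdots j_q}$ are the components of a $(0,q)$-tensor in the natural basis (so the barred index $\bar j$ stands for the multi-index $(j_1,\dots,j_q)$). Purity: $\xi\in\Im^0_q(M)$ is pure with respect to $\varphi\in\Im^1_1(M)$ if $$\varphi^r_{j_1}\xi_{r j_2\cdots j_q}=\varphi^r_{j_2}\xi_{j_1 r\cdots j_q}=\cdots=\varphi^r_{j_q}\xi_{j_1\cdots j_{q-1}r}=:\overset{*}{\xi}_{j_1\cdots j_q}$$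 (for $q=1$ every covector field is considered pure). Tachibana operator: for $\xi$ pure with respect to $\varphi$, $$(\Phi_\varphi\xi)_{lk_1\cdots k_q}=\varphi_l^m\partial_m\xi_{k_1\cdots k_q}-\partial_l\overset{*}{\xi}_{k_1\cdots k_q}+\sum_{a=1}^q(\partial_{k_a}\varphi_l^m)\,\xi_{k_1\cdots m\cdots k_q},$$ where in the last sum $m$ stands in the $a$-th position. When $\varphi$ is an almost complex structure, a pure tensor $\xi$ with $\Phi_\varphi\xi=0$ is called an almost analytic $(0,q)$-tensor. Cross-section and adapted frame: $\xi\in\Im^0_q(M)$ determines the section $\sigma_\xi:M\to T^0_q(M)$, $x\mapsto\xi_x$, and the $n$-dimensional submanifold $\sigma_\xi(M)$, locally given by $x^k=x^k$, $x^{\bar k}=\xi_{k_1\cdots k_q}(x)$. If $\xi$ is pure with respect to $\varphi$ it is called a pure cross-section and denoted $\sigma^\varphi_\xi(M)$. Along $\sigma_\xi(M)$ the adapted $(B,C)$-frame consists of the $n$ tangent vector fields $B_j$ and the $n^q$ vertical vector fields $C_{\bar j}$ ($\bar j=(j_1,\dots,j_q)$) with components in the natural frame $\{\partial_k,\partial_{\bar k}\}$ $$B_j=\begin{pmatrix}\delta^k_j\\ \partial_j\xi_{k_1\cdots k_q}\end{pmatrix},\qquad C_{\bar j}=\begin{pmatrix}0\\ \delta^{j_1}_{k_1}\cdots\delta^{j_q}_{k_q}\end{pmatrix}.$$ Complete lift: the complete lift ${}^C\varphi$ of $\varphi$ along the pure cross-section $\sigma^\varphi_\xi(M)$ is the field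 of endomorphisms of the tangent spaces of $T^0_q(M)$ at points of $\sigma^\varphi_\xi(M)$ whose matrix in the adapted $(B,C)$-frame is $${}^C\varphi=\begin{pmatrix}\varphi^k_l&0\\ -(\Phi_\varphi\xi)_{lk_1\cdots k_q}&\varphi^{r_1}_{k_1}\delta^{r_2}_{k_2}\cdots\delta^{r_q}_{k_q}\end{pmatrix},$$ where the row index is $(k,\bar k)$ with $\bar k=(k_1,\dots,k_q)$ and the column index is $(l,\bar r)$ with $\bar r=(r_1,\dots,r_q)$; that is, ${}^C\varphi(B_l)=\varphi_l^kB_k-(\Phi_\varphi\xi)_{lk_1\cdots k_q}C_{\bar k}$ and ${}^C\varphi(C_{\bar r})=\varphi^{r_1}_{k_1}\delta^{r_2}_{k_2}\cdots\delta^{r_q}_{k_q}C_{\bar k}$. *)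

theory Defs
  imports "HOL-Analysis.Analysis" "HOL-Library.Function_Algebras"
begin

section \<open>Preliminaries\<close>

instantiation "fun" :: (type, real_vector) real_vector
begin

definition scaleR_fun :: "real \<Rightarrow> ('a \<Rightarrow> 'b) \<Rightarrow> 'a \<Rightarrow> 'b" where
  "scaleR_fun c f = (\<lambda>x. c *\<^sub>R f x)"

instance
  by standard (auto simp: scaleR_fun_def fun_eq_iff algebra_simps)

end

primrec Ck_on :: "nat \<Rightarrow> 'a::euclidean_space set \<Rightarrow> ('a \<Rightarrow> 'b::real_normed_vector) \<Rightarrow> bool" where
  "Ck_on 0 S f \<longleftrightarrow> continuous_on S f"
| "Ck_on (Suc k) S f \<longleftrightarrow>
     (\<forall>x\<in>S. f differentiable (at x)) \<and> (\<forall>v. Ck_on k S (\<lambda>x. frechet_derivative f (at x) v))"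

text \<open>Only used for open \<open>S\<close>.\<close>
definition smooth_on :: "'a::euclidean_space set \<Rightarrow> ('a \<Rightarrow> 'b::real_normed_vector) \<Rightarrow> bool" where
  "smooth_on S f \<longleftrightarrow> (\<forall>k. Ck_on k S f)"

text \<open>Linear endomorphisms of a linear subspace \<open>T\<close>.\<close>
definition linear_endo :: "'v::real_vector set \<Rightarrow> ('v \<Rightarrow> 'v) \<Rightarrow> bool" where
  "linear_endo T F \<longleftrightarrow>
     (\<forall>v\<in>T. F v \<in> T) \<and>
     (\<forall>v\<in>T. \<forall>w\<in>T. F (v + w) = F v + F w) \<and>
     (\<forall>c. \<forall>v\<in>T. F (c *\<^sub>R v) = c *\<^sub>R F v)"


section \<open>Smooth manifolds\<close>

text \<open>A chart is a pair \<open>(U, x)\<close> of a domain and a coordinate map; the values of \<open>x\<close> outside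
  \<open>U\<close> are irrelevant.  The manifold is given by its atlas: the underlying set and the topology
  are recovered from it.\<close>

type_synonym ('m, 'e) chart = "'m set \<times> ('m \<Rightarrow> 'e)"

definition transition :: "('m, 'e) chart \<Rightarrow> ('m, 'e) chart \<Rightarrow> 'e \<Rightarrow> 'e" where
  "transition \<kappa> \<kappa>' = (\<lambda>y. snd \<kappa>' (inv_into (fst \<kappa>) (snd \<kappa>) y))"

definition smooth_atlas :: "('m, 'e::euclidean_space) chart set \<Rightarrow> bool" where
  "smooth_atlas A \<longleftrightarrow>
     (\<forall>\<kappa>\<in>A. inj_on (snd \<kappa>) (fst \<kappa>) \<and> open (snd \<kappa> ` fst \<kappa>)) \<and>
     (\<forall>\<kappa>\<in>A. \<forall>\<kappa>'\<in>A. open (snd \<kappa> ` (fst \<kappa> \<inter> fst \<kappa>')) \<and>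
        smooth_on (snd \<kappa> ` (fst \<kappa> \<inter> fst \<kappa>')) (transition \<kappa> \<kappa>'))"

definition points :: "('m, 'e) chart set \<Rightarrow> 'm set" where
  "points A = (\<Union>\<kappa>\<in>A. fst \<kappa>)"

definition atlas_topology :: "('m, 'e::euclidean_space) chart set \<Rightarrow> 'm topology" where
  "atlas_topology A =
     topology (\<lambda>V. V \<subseteq> points A \<and> (\<forall>\<kappa>\<in>A. open (snd \<kappa> ` (V \<inter> fst \<kappa>))))"

lemma openin_atlas_topology:
  assumes "smooth_atlas A"
  shows "openin (atlas_topology A) V \<longleftrightarrow>
           V \<subseteq> points A \<and> (\<forall>\<kappa>\<in>A. open (snd \<kappa> ` (V \<inter> fst \<kappa>)))"
proof -
  have inj: "inj_on (snd \<kappa>) (fst \<kappa>)" if "\<kappa> \<in> A" for \<kappa>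
    using assms that by (simp add: smooth_atlas_def)
  have *: "snd \<kappa> ` (S \<inter> T \<inter> fst \<kappa>) = snd \<kappa> ` (S \<inter> fst \<kappa>) \<inter> snd \<kappa> ` (T \<inter> fst \<kappa>)"
    if "\<kappa> \<in> A" for \<kappa> S T
    using inj_on_image_Int[OF inj[OF that], of "S \<inter> fst \<kappa>" "T \<inter> fst \<kappa>"]
    by (simp add: Int_ac)
  have **: "snd \<kappa> ` (\<Union>K \<inter> fst \<kappa>) = (\<Union>S\<in>K. snd \<kappa> ` (S \<inter> fst \<kappa>))" for \<kappa> :: "('a, 'b) chart" and K
    by auto
  have "istopology (\<lambda>V. V \<subseteq> points A \<and> (\<forall>\<kappa>\<in>A. open (snd \<kappa> ` (V \<inter> fst \<kappa>))))"
    unfolding istopology_def using * ** by (auto intro!: open_Int open_UN)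
  then show ?thesis
    by (simp add: atlas_topology_def)
qed

definition smooth_manifold :: "('m, 'e::euclidean_space) chart set \<Rightarrow> bool" where
  "smooth_manifold A \<longleftrightarrow>
     smooth_atlas A \<and> Hausdorff_space (atlas_topology A) \<and> second_countable (atlas_topology A)"


section \<open>Tangent spaces\<close>

text \<open>A tangent vector at \<open>p\<close> is a family of component vectors, one for each chart around \<open>p\<close>,
  obeying the contravariant transformation law.  The value \<open>0\<close> at all other charts is a
  normalisation that makes the representation unique.\<close>

type_synonym ('m, 'e) tangent = "('m, 'e) chart \<Rightarrow> 'e"

definition tangent_space ::
  "('m, 'e::euclidean_space) chart set \<Rightarrow> 'm \<Rightarrow> ('m, 'e) tangent set" where
  "tangent_space A p = {v.
     (\<forall>\<kappa>. \<not> (\<kappa> \<in> A \<and> p \<in> fst \<kappa>) \<longrightarrow> v \<kappa> = 0) \<and>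
     (\<forall>\<kappa>\<in>A. \<forall>\<kappa>'\<in>A. p \<in> fst \<kappa> \<and> p \<in> fst \<kappa>' \<longrightarrow>
        v \<kappa>' = frechet_derivative (transition \<kappa> \<kappa>') (at (snd \<kappa> p)) (v \<kappa>))}"

text \<open>The tangent vector at \<open>p\<close> with component vector \<open>e\<close> in the chart \<open>\<kappa>\<close>.\<close>
definition tangent_of ::
  "('m, 'e::euclidean_space) chart set \<Rightarrow> ('m, 'e) chart \<Rightarrow> 'm \<Rightarrow> 'e \<Rightarrow> ('m, 'e) tangent" where
  "tangent_of A \<kappa> p e = (\<lambda>\<kappa>'. if \<kappa>' \<in> A \<and> p \<in> fst \<kappa>'
     then frechet_derivative (transition \<kappa> \<kappa>') (at (snd \<kappa> p)) e else 0)"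

text \<open>\<open>natural_frame A \<kappa> p j\<close> is the coordinate vector \<open>\<partial>\<^sub>j\<close> of \<open>\<kappa>\<close> at \<open>p\<close>.\<close>
definition natural_frame ::
  "('m, real^'n) chart set \<Rightarrow> ('m, real^'n) chart \<Rightarrow> 'm \<Rightarrow> 'n::finite \<Rightarrow> ('m, real^'n) tangent" where
  "natural_frame A \<kappa> p j = tangent_of A \<kappa> p (axis j 1)"

text \<open>The coordinate expression of a function on the manifold, and its partial derivatives.\<close>

definition in_chart :: "('m, 'e) chart \<Rightarrow> ('m \<Rightarrow> 'b) \<Rightarrow> 'e \<Rightarrow> 'b" where
  "in_chart \<kappa> g = (\<lambda>y. g (inv_into (fst \<kappa>) (snd \<kappa>) y))"

definition pderiv_chart ::
  "('m, real^'n) chart \<Rightarrow> 'n::finite \<Rightarrow> ('m \<Rightarrow> real) \<Rightarrow> 'm \<Rightarrow> real" where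
  "pderiv_chart \<kappa> j g p = frechet_derivative (in_chart \<kappa> g) (at (snd \<kappa> p)) (axis j 1)"


section \<open>Tensor fields of type (1,1) and almost complex structures\<close>

text \<open>\<open>endo_comp A \<phi> \<kappa> k j p\<close> is the component \<open>\<phi>\<^sup>k\<^sub>j\<close>
  (upper index \<open>k\<close>, lower index \<open>j\<close>), so that \<open>\<phi>(\<partial>\<^sub>j) = \<phi>\<^sup>k\<^sub>j \<partial>\<^sub>k\<close>.\<close>
definition endo_comp ::
  "('m, real^'n) chart set \<Rightarrow> ('m \<Rightarrow> ('m, real^'n) tangent \<Rightarrow> ('m, real^'n) tangent) \<Rightarrow>
   ('m, real^'n) chart \<Rightarrow> 'n::finite \<Rightarrow> 'n \<Rightarrow> 'm \<Rightarrow> real" where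
  "endo_comp A \<phi> \<kappa> k j p = \<phi> p (natural_frame A \<kappa> p j) \<kappa> $ k"

definition endo_field ::
  "('m, real^'n) chart set \<Rightarrow>
   ('m \<Rightarrow> ('m, real^'n::finite) tangent \<Rightarrow> ('m, real^'n) tangent) \<Rightarrow> bool" where
  "endo_field A \<phi> \<longleftrightarrow>
     (\<forall>p\<in>points A. linear_endo (tangent_space A p) (\<phi> p)) \<and>
     (\<forall>\<kappa>\<in>A. \<forall>k j. smooth_on (snd \<kappa> ` fst \<kappa>) (in_chart \<kappa> (endo_comp A \<phi> \<kappa> k j)))"

text \<open>A field \<open>F\<close> of endomorphisms of the tangent spaces at the points of \<open>S\<close> is an almost
  complex structure along \<open>S\<close> if \<open>F\<^sup>2 = -I\<close> there.\<close>
definition almost_complex_along ::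
  "('m, 'e::euclidean_space) chart set \<Rightarrow> 'm set \<Rightarrow>
   ('m \<Rightarrow> ('m, 'e) tangent \<Rightarrow> ('m, 'e) tangent) \<Rightarrow> bool" where
  "almost_complex_along A S F \<longleftrightarrow>
     (\<forall>p\<in>S. linear_endo (tangent_space A p) (F p) \<and>
            (\<forall>v\<in>tangent_space A p. F p (F p v) = - v))"

definition almost_complex_structure ::
  "('m, real^'n) chart set \<Rightarrow>
   ('m \<Rightarrow> ('m, real^'n::finite) tangent \<Rightarrow> ('m, real^'n) tangent) \<Rightarrow> bool" where
  "almost_complex_structure A \<phi> \<longleftrightarrow>
     endo_field A \<phi> \<and> almost_complex_along A (points A) \<phi>"


section \<open>Covariant tensors\<close>

text \<open>The \<open>q\<close> argument slots are the elements of a finite linearly ordered type \<open>'q\<close>,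
  \<open>q = CARD('q)\<close>; a multi-index \<open>(j\<^sub>1, \<dots>, j\<^sub>q)\<close> is a function \<open>J :: 'q \<Rightarrow> 'n\<close>.  Replacing
  the index in slot \<open>a\<close> by \<open>m\<close> is \<open>J(a := m)\<close>.  The slots are ordered only in order to single
  out the first one.\<close>

definition first_slot :: "'q::{finite,linorder}" where
  "first_slot = Min UNIV"

type_synonym ('m, 'n, 'q) cotensor = "('q \<Rightarrow> ('m, real^'n) tangent) \<Rightarrow> real"

text \<open>Multilinear forms on the tangent space; the value \<open>0\<close> on families that do not consist of
  tangent vectors at \<open>p\<close> is again a normalisation.\<close>
definition cotensors ::
  "('m, real^'n) chart set \<Rightarrow> 'm \<Rightarrow> ('m, 'n::finite, 'q) cotensor set" where
  "cotensors A p = {t.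
     (\<forall>vs. \<not> range vs \<subseteq> tangent_space A p \<longrightarrow> t vs = 0) \<and>
     (\<forall>vs a. range vs \<subseteq> tangent_space A p \<longrightarrow>
        (\<forall>v\<in>tangent_space A p. \<forall>w\<in>tangent_space A p.
           t (vs(a := v + w)) = t (vs(a := v)) + t (vs(a := w))) \<and>
        (\<forall>c. \<forall>v\<in>tangent_space A p. t (vs(a := c *\<^sub>R v)) = c * t (vs(a := v))))}"

definition cotensor_comp ::
  "('m, real^'n) chart set \<Rightarrow> ('m, real^'n) chart \<Rightarrow> 'm \<Rightarrow>
   ('m, 'n::finite, 'q) cotensor \<Rightarrow> ('q \<Rightarrow> 'n) \<Rightarrow> real" where
  "cotensor_comp A \<kappa> p t J = t (\<lambda>a. natural_frame A \<kappa> p (J a))"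

text \<open>The components \<open>\<xi>\<^bsub>j\<^sub>1\<dots>j\<^sub>q\<^esub>\<close> of a field, as functions on the chart domain.\<close>
definition field_comp ::
  "('m, real^'n) chart set \<Rightarrow> ('m \<Rightarrow> ('m, 'n::finite, 'q) cotensor) \<Rightarrow>
   ('m, real^'n) chart \<Rightarrow> ('q \<Rightarrow> 'n) \<Rightarrow> 'm \<Rightarrow> real" where
  "field_comp A \<xi> \<kappa> J p = cotensor_comp A \<kappa> p (\<xi> p) J"

definition cotensor_field ::
  "('m, real^'n) chart set \<Rightarrow> ('m \<Rightarrow> ('m, 'n::finite, 'q) cotensor) \<Rightarrow> bool" where
  "cotensor_field A \<xi> \<longleftrightarrow>
     (\<forall>p\<in>points A. \<xi> p \<in> cotensors A p) \<and>
     (\<forall>\<kappa>\<in>A. \<forall>J. smooth_on (snd \<kappa> ` fst \<kappa>) (in_chart \<kappa> (field_comp A \<xi> \<kappa> J)))"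


section \<open>Purity, Tachibana operator, almost analytic tensors\<close>

text \<open>\<open>\<phi>\<^sup>r\<^bsub>j\<^sub>a\<^esub> \<xi>\<^bsub>j\<^sub>1\<dots>r\<dots>j\<^sub>q\<^esub>\<close> with \<open>r\<close> in slot \<open>a\<close>.\<close>
definition contract ::
  "('m, real^'n) chart set \<Rightarrow> ('m \<Rightarrow> ('m, real^'n) tangent \<Rightarrow> ('m, real^'n) tangent) \<Rightarrow>
   ('m \<Rightarrow> ('m, 'n::finite, 'q) cotensor) \<Rightarrow> ('m, real^'n) chart \<Rightarrow> 'q \<Rightarrow> ('q \<Rightarrow> 'n) \<Rightarrow> 'm \<Rightarrow> real" where
  "contract A \<phi> \<xi> \<kappa> a J p =
     (\<Sum>r\<in>UNIV. endo_comp A \<phi> \<kappa> r (J a) p * field_comp A \<xi> \<kappa> (J(a := r)) p)"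

definition pure_wrt ::
  "('m, real^'n) chart set \<Rightarrow> ('m \<Rightarrow> ('m, real^'n) tangent \<Rightarrow> ('m, real^'n) tangent) \<Rightarrow>
   ('m \<Rightarrow> ('m, 'n::finite, 'q) cotensor) \<Rightarrow> bool" where
  "pure_wrt A \<phi> \<xi> \<longleftrightarrow>
     (\<forall>\<kappa>\<in>A. \<forall>p\<in>fst \<kappa>. \<forall>J a b. contract A \<phi> \<xi> \<kappa> a J p = contract A \<phi> \<xi> \<kappa> b J p)"

text \<open>\<open>tachibana A \<phi> \<xi> \<kappa> l K p\<close> is \<open>(\<Phi>\<^sub>\<phi>\<xi>)\<^bsub>l k\<^sub>1\<dots>k\<^sub>q\<^esub>\<close>.  For pure \<open>\<xi>\<close> the slot used for the
  starred tensor is immaterial.\<close>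
definition tachibana ::
  "('m, real^'n) chart set \<Rightarrow> ('m \<Rightarrow> ('m, real^'n) tangent \<Rightarrow> ('m, real^'n) tangent) \<Rightarrow>
   ('m \<Rightarrow> ('m, 'n::finite, 'q::{finite,linorder}) cotensor) \<Rightarrow>
   ('m, real^'n) chart \<Rightarrow> 'n \<Rightarrow> ('q \<Rightarrow> 'n) \<Rightarrow> 'm \<Rightarrow> real" where
  "tachibana A \<phi> \<xi> \<kappa> l K p =
     (\<Sum>m\<in>UNIV. endo_comp A \<phi> \<kappa> m l p * pderiv_chart \<kappa> m (field_comp A \<xi> \<kappa> K) p)
     - pderiv_chart \<kappa> l (contract A \<phi> \<xi> \<kappa> first_slot K) p
     + (\<Sum>a\<in>UNIV. \<Sum>m\<in>UNIV.
          pderiv_chart \<kappa> (K a) (endo_comp A \<phi> \<kappa> m l) p * field_comp A \<xi> \<kappa> (K(a := m)) p)"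

definition almost_analytic ::
  "('m, real^'n) chart set \<Rightarrow> ('m \<Rightarrow> ('m, real^'n) tangent \<Rightarrow> ('m, real^'n) tangent) \<Rightarrow>
   ('m \<Rightarrow> ('m, 'n::finite, 'q::{finite,linorder}) cotensor) \<Rightarrow> bool" where
  "almost_analytic A \<phi> \<xi> \<longleftrightarrow>
     cotensor_field A \<xi> \<and> pure_wrt A \<phi> \<xi> \<and>
     (\<forall>\<kappa>\<in>A. \<forall>p\<in>fst \<kappa>. \<forall>l K. tachibana A \<phi> \<xi> \<kappa> l K p = 0)"


section \<open>The tensor bundle and the adapted frame\<close>

type_synonym ('m, 'n, 'q) bundle_point = "'m \<times> ('m, 'n, 'q) cotensor"
type_synonym ('n, 'q) bundle_model = "(real^'n) \<times> (real^('q \<Rightarrow> 'n))"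

definition bundle_chart ::
  "('m, real^'n) chart set \<Rightarrow> ('m, real^'n) chart \<Rightarrow>
   (('m, 'n::finite, 'q::finite) bundle_point, ('n, 'q) bundle_model) chart" where
  "bundle_chart A \<kappa> =
     (SIGMA p:fst \<kappa>. cotensors A p, \<lambda>(p, t). (snd \<kappa> p, \<chi> J. cotensor_comp A \<kappa> p t J))"

definition tensor_bundle ::
  "('m, real^'n) chart set \<Rightarrow>
   (('m, 'n::finite, 'q::finite) bundle_point, ('n, 'q) bundle_model) chart set" where
  "tensor_bundle A = bundle_chart A ` A"

definition cross_section ::
  "('m, real^'n) chart set \<Rightarrow> ('m \<Rightarrow> ('m, 'n::finite, 'q::finite) cotensor) \<Rightarrow>
   ('m, 'n, 'q) bundle_point set" where
  "cross_section A \<xi> = (\<lambda>p. (p, \<xi> p)) ` points A"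

type_synonym ('m, 'n, 'q) bundle_tangent =
  "(('m, 'n, 'q) bundle_point, ('n, 'q) bundle_model) tangent"

definition B_frame ::
  "('m, real^'n) chart set \<Rightarrow> ('m \<Rightarrow> ('m, 'n::finite, 'q::finite) cotensor) \<Rightarrow>
   ('m, real^'n) chart \<Rightarrow> 'm \<Rightarrow> 'n \<Rightarrow> ('m, 'n, 'q) bundle_tangent" where
  "B_frame A \<xi> \<kappa> p j =
     tangent_of (tensor_bundle A) (bundle_chart A \<kappa>) (p, \<xi> p)
       (axis j 1, \<chi> K. pderiv_chart \<kappa> j (field_comp A \<xi> \<kappa> K) p)"

definition C_frame ::
  "('m, real^'n) chart set \<Rightarrow> ('m \<Rightarrow> ('m, 'n::finite, 'q::finite) cotensor) \<Rightarrow>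
   ('m, real^'n) chart \<Rightarrow> 'm \<Rightarrow> ('q \<Rightarrow> 'n) \<Rightarrow> ('m, 'n, 'q) bundle_tangent" where
  "C_frame A \<xi> \<kappa> p J =
     tangent_of (tensor_bundle A) (bundle_chart A \<kappa>) (p, \<xi> p) (0, axis J 1)"


section \<open>The complete lift along a cross-section\<close>

text \<open>\<open>F\<close> is an endomorphism of the tangent space at the point \<open>(p, \<xi> p)\<close> that has the
  prescribed matrix in the adapted frame of every chart around \<open>p\<close>.\<close>
definition is_complete_lift_at ::
  "('m, real^'n) chart set \<Rightarrow> ('m \<Rightarrow> ('m, real^'n) tangent \<Rightarrow> ('m, real^'n) tangent) \<Rightarrow>
   ('m \<Rightarrow> ('m, 'n::finite, 'q::{finite,linorder}) cotensor) \<Rightarrow> 'm \<Rightarrow>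
   (('m, 'n, 'q) bundle_tangent \<Rightarrow> ('m, 'n, 'q) bundle_tangent) \<Rightarrow> bool" where
  "is_complete_lift_at A \<phi> \<xi> p F \<longleftrightarrow>
     F \<in> extensional (tangent_space (tensor_bundle A) (p, \<xi> p)) \<and>
     linear_endo (tangent_space (tensor_bundle A) (p, \<xi> p)) F \<and>
     (\<forall>\<kappa>\<in>A. p \<in> fst \<kappa> \<longrightarrow>
        (\<forall>l. F (B_frame A \<xi> \<kappa> p l) =
               (\<Sum>k\<in>UNIV. endo_comp A \<phi> \<kappa> k l p *\<^sub>R B_frame A \<xi> \<kappa> p k)
               - (\<Sum>K\<in>UNIV. tachibana A \<phi> \<xi> \<kappa> l K p *\<^sub>R C_frame A \<xi> \<kappa> p K)) \<and>
        (\<forall>R. F (C_frame A \<xi> \<kappa> p R) =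
               (\<Sum>K\<in>UNIV.
                  (endo_comp A \<phi> \<kappa> (R first_slot) (K first_slot) p *
                   (\<Prod>a\<in>UNIV - {first_slot}. if R a = K a then 1 else 0))
                  *\<^sub>R C_frame A \<xi> \<kappa> p K)))"

definition complete_lift ::
  "('m, real^'n) chart set \<Rightarrow> ('m \<Rightarrow> ('m, real^'n) tangent \<Rightarrow> ('m, real^'n) tangent) \<Rightarrow>
   ('m \<Rightarrow> ('m, 'n::finite, 'q::{finite,linorder}) cotensor) \<Rightarrow> ('m, 'n, 'q) bundle_point \<Rightarrow>
   ('m, 'n, 'q) bundle_tangent \<Rightarrow> ('m, 'n, 'q) bundle_tangent" where
  "complete_lift A \<phi> \<xi> u = (THE F. is_complete_lift_at A \<phi> \<xi> (fst u) F)"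

end

theory Submission
  imports Defs
begin

text \<open>Write \<open>d\<xi>\<close> for the differential of the section \<open>\<sigma>\<^sub>\<xi>\<close>.  Every tangent vector of the bundle at
  \<open>\<xi>\<^sub>p\<close> is uniquely \<open>d\<xi>(w) + vert(t)\<close> with \<open>w\<close> tangent to \<open>M\<close> at \<open>p\<close> and \<open>t\<close> a \<open>(0,q)\<close>-tensor at \<open>p\<close>,
  and \<open>B\<^sub>l = d\<xi>(\<partial>\<^sub>l)\<close>, while the \<open>C\<close> are the vertical lifts of the dual basis of the tensors.  As the
  Tachibana operator vanishes, the matrix of the complete lift is that of
  \<open>d\<xi>(w) + vert(t) \<mapsto> d\<xi>(\<phi> w) + vert(t(\<phi> \<cdot>, \<cdot>, \<dots>, \<cdot>))\<close>.  This map does not depend on a chart, so the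
  complete lift exists and equals it; its square is \<open>-I\<close> because \<open>\<phi>\<^sup>2 = -I\<close>.\<close>

section \<open>Functions, derivatives and endomorphisms\<close>

lemma scaleR_fun_apply [simp]: "(c *\<^sub>R f) x = c *\<^sub>R f x"
  by (simp add: scaleR_fun_def)

lemma smooth_on_differentiable:
  assumes "smooth_on S f" "x \<in> S"
  shows "f differentiable (at x)"
proof -
  have "Ck_on (Suc 0) S f"
    using assms(1) by (simp only: smooth_on_def)
  then show ?thesis
    using assms(2) by simp
qed

text \<open>The second derivative enters because the fibre part of a bundle transition contains
  entries of a Jacobian, which must itself depend differentiably on the base point.\<close>

lemma smooth_on_derivative_differentiable:
  assumes "smooth_on S f" "x \<in> S"
  shows "(\<lambda>y. frechet_derivative f (at y) v) differentiable (at x)"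
proof -
  have "Ck_on (Suc (Suc 0)) S f"
    using assms(1) by (simp only: smooth_on_def)
  then show ?thesis
    using assms(2) by simp
qed

lemma differentiable_vec_lambda:
  assumes "\<And>i. f i differentiable (at x)"
  shows "(\<lambda>y. (\<chi> i. f i y) :: real^'n::finite) differentiable (at x)"
  using assms by (subst differentiable_componentwise_within) (auto simp: Basis_vec_def inner_axis)

lemma has_derivative_vec_lambda:
  assumes "\<And>i. (f i has_derivative f' i) (at x)"
  shows "((\<lambda>y. (\<chi> i. f i y) :: real^'n::finite) has_derivative (\<lambda>e. \<chi> i. f' i e)) (at x)"
  using assms by (subst has_derivative_componentwise_within) (auto simp: Basis_vec_def inner_axis)

lemma differentiable_Pair_at:
  assumes "f differentiable (at x)" "g differentiable (at x)"
  shows "(\<lambda>y. (f y, g y)) differentiable (at x)"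
  using assms has_derivative_Pair unfolding differentiable_def by blast

lemma differentiable_prod_real:
  fixes f :: "'i \<Rightarrow> 'a::real_normed_vector \<Rightarrow> real"
  assumes "\<And>i. i \<in> I \<Longrightarrow> f i differentiable (at x)"
  shows "(\<lambda>y. \<Prod>i\<in>I. f i y) differentiable (at x)"
proof -
  have "\<forall>i\<in>I. \<exists>D. (f i has_derivative D) (at x)"
    using assms by (simp add: differentiable_def)
  then obtain D where "\<And>i. i \<in> I \<Longrightarrow> (f i has_derivative D i) (at x)"
    by metis
  then show ?thesis
    using has_derivative_prod[of I f D x UNIV] differentiable_def by blast
qed

lemma vec_eq_sum_axis: "x = (\<Sum>i\<in>UNIV. x $ i *\<^sub>R axis i 1)" for x :: "real^'n::finite"
  using basis_expansion[of x] by (simp add: scalar_mult_eq_scaleR)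

lemma sum_fun_apply: "(\<Sum>i\<in>I. f i) x = (\<Sum>i\<in>I. f i x :: 'b::comm_monoid_add)"
  by (induction I rule: infinite_finite_induct) auto

lemma range_fun_upd_subset:
  assumes "range f \<subseteq> T" "x \<in> T"
  shows "range (f(a := x)) \<subseteq> T"
  using assms by auto

text \<open>Isolates the only factor that sees slot \<open>a\<close>, so that a product of
  components is additive and homogeneous in each slot.\<close>

lemma prod_fun_upd:
  fixes g :: "'a::finite \<Rightarrow> 'b \<Rightarrow> real"
  shows "(\<Prod>b\<in>UNIV. g b ((f(a := x)) b)) = g a x * (\<Prod>b\<in>UNIV - {a}. g b (f b))"
  by (subst prod.remove[of _ a]) (auto intro!: prod.cong)

text \<open>\<open>linear_endo\<close> constrains \<open>F\<close> on \<open>T\<close> only, so the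
  induction has to keep every partial sum inside the subspace.\<close>

lemma linear_endo_sum:
  assumes "linear_endo T F" "subspace T" "\<And>i. i \<in> I \<Longrightarrow> f i \<in> T"
  shows "F (\<Sum>i\<in>I. c i *\<^sub>R f i) = (\<Sum>i\<in>I. c i *\<^sub>R F (f i))"
  using assms(3)
proof (induction I rule: infinite_finite_induct)
  case (insert i I)
  then show ?case
    using assms(1,2) by (simp add: linear_endo_def subspace_sum subspace_scale)
next
  case empty
  \<comment> \<open>Homogeneity with the scalar 0 gives \<open>F 0 = 0\<close>, the value for the
    empty sum and for the sum over an infinite set.\<close>
  have "F (0 *\<^sub>R 0) = 0 *\<^sub>R F 0"
    using assms(1,2) subspace_0 unfolding linear_endo_def by blast
  then show ?case by simp
next
  case (infinite I)
  have "F (0 *\<^sub>R 0) = 0 *\<^sub>R F 0"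
    using assms(1,2) subspace_0 unfolding linear_endo_def by blast
  with infinite show ?case by simp
qed

section \<open>Tangent spaces of differentiable atlases\<close>

text \<open>The first-order part of \<^const>\<open>smooth_atlas\<close>; it suffices for the tangent spaces, and it is
  all that has to be checked for the charts of the tensor bundle.\<close>

locale differentiable_atlas =
  fixes C :: "('m, 'e::euclidean_space) chart set"
  assumes chart_inj: "\<kappa> \<in> C \<Longrightarrow> inj_on (snd \<kappa>) (fst \<kappa>)"
    and overlap_open: "\<kappa> \<in> C \<Longrightarrow> \<kappa>' \<in> C \<Longrightarrow> open (snd \<kappa> ` (fst \<kappa> \<inter> fst \<kappa>'))"
    and transition_differentiable: "\<kappa> \<in> C \<Longrightarrow> \<kappa>' \<in> C \<Longrightarrow> p \<in> fst \<kappa> \<Longrightarrow> p \<in> fst \<kappa>' \<Longrightarrow>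
      transition \<kappa> \<kappa>' differentiable (at (snd \<kappa> p))"
begin

abbreviation jacobian :: "('m, 'e) chart \<Rightarrow> ('m, 'e) chart \<Rightarrow> 'm \<Rightarrow> 'e \<Rightarrow> 'e" where
  "jacobian \<kappa> \<kappa>' p \<equiv> frechet_derivative (transition \<kappa> \<kappa>') (at (snd \<kappa> p))"

lemma transition_chart:
  assumes "\<kappa> \<in> C" "p \<in> fst \<kappa>"
  shows "transition \<kappa> \<kappa>' (snd \<kappa> p) = snd \<kappa>' p"
  using assms chart_inj by (simp add: transition_def)

lemma in_chart_chart:
  assumes "\<kappa> \<in> C" "p \<in> fst \<kappa>"
  shows "in_chart \<kappa> g (snd \<kappa> p) = g p"
  using assms chart_inj by (simp add: in_chart_def)

lemma jacobian_has_derivative: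
  assumes "\<kappa> \<in> C" "\<kappa>' \<in> C" "p \<in> fst \<kappa>" "p \<in> fst \<kappa>'"
  shows "(transition \<kappa> \<kappa>' has_derivative jacobian \<kappa> \<kappa>' p) (at (snd \<kappa> p))"
  using transition_differentiable[OF assms] frechet_derivative_works by blast

lemma linear_jacobian:
  assumes "\<kappa> \<in> C" "\<kappa>' \<in> C" "p \<in> fst \<kappa>" "p \<in> fst \<kappa>'"
  shows "linear (jacobian \<kappa> \<kappa>' p)"
  using jacobian_has_derivative[OF assms] has_derivative_linear by blast

text \<open>The chain rule for local expressions \<open>s\<close>, \<open>s'\<close> of one and the same map.\<close>

lemma jacobian_chain:
  assumes "\<kappa> \<in> C" "\<kappa>' \<in> C" "p \<in> fst \<kappa>" "p \<in> fst \<kappa>'"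
    and "(s has_derivative S) (at (snd \<kappa> p))"
    and "(s' has_derivative S') (at (snd \<kappa>' p))"
    and "open V" "snd \<kappa> p \<in> V"
    and "\<And>y. y \<in> V \<Longrightarrow> s y = s' (transition \<kappa> \<kappa>' y)"
  shows "S e = S' (jacobian \<kappa> \<kappa>' p e)"
proof -
  have "((s' \<circ> transition \<kappa> \<kappa>') has_derivative S' \<circ> jacobian \<kappa> \<kappa>' p) (at (snd \<kappa> p))"
    using assms(1-4,6) by (intro diff_chain_at jacobian_has_derivative) (auto simp: transition_chart)
  \<comment> \<open>\<open>s\<close> agrees with the composite only on \<open>V\<close>; an open
    neighbourhood of the point suffices to transfer the derivative, and uniqueness of derivatives
    then equates the two linear maps.\<close>
  then have "(s has_derivative S' \<circ> jacobian \<kappa> \<kappa>' p) (at (snd \<kappa> p))"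
    by (rule has_derivative_transform_within_open[OF _ assms(7,8)]) (simp add: assms(9))
  then have "S = S' \<circ> jacobian \<kappa> \<kappa>' p"
    using assms(5) has_derivative_unique by blast
  then show ?thesis by simp
qed

lemma jacobian_cocycle:
  assumes "\<kappa> \<in> C" "\<kappa>' \<in> C" "\<kappa>'' \<in> C" "p \<in> fst \<kappa>" "p \<in> fst \<kappa>'" "p \<in> fst \<kappa>''"
  shows "jacobian \<kappa>' \<kappa>'' p (jacobian \<kappa> \<kappa>' p e) = jacobian \<kappa> \<kappa>'' p e"
proof -
  \<comment> \<open>The image of the triple overlap. As an intersection of two pairwise overlaps it
    is visibly open; injectivity of the chart turns it into the image of one set of points, on which
    both transitions can be evaluated.\<close>
  let ?V = "snd \<kappa> ` (fst \<kappa> \<inter> fst \<kappa>') \<inter> snd \<kappa> ` (fst \<kappa> \<inter> fst \<kappa>'')"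
  have V: "?V = snd \<kappa> ` ((fst \<kappa> \<inter> fst \<kappa>') \<inter> (fst \<kappa> \<inter> fst \<kappa>''))"
    using chart_inj[OF assms(1)] by (intro inj_on_image_Int[symmetric]) auto
  have "jacobian \<kappa> \<kappa>'' p e = jacobian \<kappa>' \<kappa>'' p (jacobian \<kappa> \<kappa>' p e)"
  proof (rule jacobian_chain[where V = ?V and s' = "transition \<kappa>' \<kappa>''", OF assms(1,2,4,5)])
    show "transition \<kappa> \<kappa>'' y = transition \<kappa>' \<kappa>'' (transition \<kappa> \<kappa>' y)" if "y \<in> ?V" for y
      using that assms unfolding V by (auto simp: transition_chart)
    show "open ?V"
      using assms overlap_open by blast
    show "snd \<kappa> p \<in> ?V"
      using assms by blast
  qed (use assms jacobian_has_derivative in blast)+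
  then show ?thesis by simp
qed

lemma jacobian_self:
  assumes "\<kappa> \<in> C" "p \<in> fst \<kappa>"
  shows "jacobian \<kappa> \<kappa> p e = e"
proof -
  \<comment> \<open>The self-transition is the identity only on the chart image, hence the local
    comparison on this open set.\<close>
  have "open (snd \<kappa> ` (fst \<kappa> \<inter> fst \<kappa>))"
    using assms overlap_open by blast
  then have "((\<lambda>y. y) has_derivative jacobian \<kappa> \<kappa> p) (at (snd \<kappa> p))"
    by (rule has_derivative_transform_within_open
          [OF jacobian_has_derivative[OF assms(1) assms(1) assms(2) assms(2)]])
       (use assms in \<open>auto simp: transition_chart\<close>)
  then have "jacobian \<kappa> \<kappa> p = (\<lambda>y. y)"
    by (rule has_derivative_unique[OF _ has_derivative_ident])
  then show ?thesis by simp
qed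

section \<open>Tangent vectors and their components in a chart\<close>

lemma tangent_space_jacobian:
  assumes "v \<in> tangent_space C p" "\<kappa> \<in> C" "\<kappa>' \<in> C" "p \<in> fst \<kappa>" "p \<in> fst \<kappa>'"
  shows "jacobian \<kappa> \<kappa>' p (v \<kappa>) = v \<kappa>'"
  by (rule sym) (use assms in \<open>unfold tangent_space_def, blast\<close>)

lemma tangent_spaceI:
  assumes "\<And>\<kappa>. \<not> (\<kappa> \<in> C \<and> p \<in> fst \<kappa>) \<Longrightarrow> v \<kappa> = 0"
    and "\<And>\<kappa> \<kappa>'. \<kappa> \<in> C \<Longrightarrow> \<kappa>' \<in> C \<Longrightarrow> p \<in> fst \<kappa> \<Longrightarrow> p \<in> fst \<kappa>' \<Longrightarrow>
      jacobian \<kappa> \<kappa>' p (v \<kappa>) = v \<kappa>'"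
  shows "v \<in> tangent_space C p"
  unfolding tangent_space_def
proof (intro CollectI conjI allI ballI impI)
  show "v \<kappa> = 0" if "\<not> (\<kappa> \<in> C \<and> p \<in> fst \<kappa>)" for \<kappa>
    using that by (rule assms(1))
  show "v \<kappa>' = jacobian \<kappa> \<kappa>' p (v \<kappa>)"
    if "\<kappa> \<in> C" "\<kappa>' \<in> C" "p \<in> fst \<kappa> \<and> p \<in> fst \<kappa>'" for \<kappa> \<kappa>'
    using that assms(2) by simp
qed

lemma tangent_space_zero:
  assumes "v \<in> tangent_space C p" "\<not> (\<kappa> \<in> C \<and> p \<in> fst \<kappa>)"
  shows "v \<kappa> = 0"
  using assms unfolding tangent_space_def by blast

lemma subspace_tangent_space: "subspace (tangent_space C p)"
  unfolding subspace_def
proof (intro conjI ballI allI)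
  show "0 \<in> tangent_space C p"
    by (rule tangent_spaceI) (simp_all add: linear_jacobian linear_0)
  show "v + w \<in> tangent_space C p" if v: "v \<in> tangent_space C p" and w: "w \<in> tangent_space C p" for v w
    by (rule tangent_spaceI)
       (simp_all add: linear_jacobian linear_add tangent_space_jacobian[OF v] tangent_space_jacobian[OF w]
          tangent_space_zero[OF v] tangent_space_zero[OF w])
  show "c *\<^sub>R v \<in> tangent_space C p" if v: "v \<in> tangent_space C p" for c v
    by (rule tangent_spaceI)
       (simp_all add: linear_jacobian linear_scale tangent_space_jacobian[OF v] tangent_space_zero[OF v])
qed

text \<open>The transformation law between two further charts is the cocycle identity for
  Jacobians.\<close>

lemma tangent_of_in:
  assumes "\<kappa> \<in> C" "p \<in> fst \<kappa>"
  shows "tangent_of C \<kappa> p e \<in> tangent_space C p"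
  by (rule tangent_spaceI) (use assms in \<open>auto simp: tangent_of_def jacobian_cocycle\<close>)

lemma tangent_of_apply [simp]:
  assumes "\<kappa> \<in> C" "p \<in> fst \<kappa>"
  shows "tangent_of C \<kappa> p e \<kappa> = e"
  using assms by (simp add: tangent_of_def jacobian_self)

lemma tangent_of_component:
  assumes "v \<in> tangent_space C p" "\<kappa> \<in> C" "p \<in> fst \<kappa>"
  shows "tangent_of C \<kappa> p (v \<kappa>) = v"
proof
  show "tangent_of C \<kappa> p (v \<kappa>) \<kappa>' = v \<kappa>'" for \<kappa>'
    using tangent_space_jacobian[OF assms(1,2) _ assms(3)] tangent_space_zero[OF assms(1)]
    by (simp add: tangent_of_def)
qed

text \<open>The transformation law and the normalisation rebuild all components of a vector from the
  one at \<open>\<kappa>\<close>.\<close>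

lemma tangent_eqI:
  assumes "v \<in> tangent_space C p" "w \<in> tangent_space C p" "\<kappa> \<in> C" "p \<in> fst \<kappa>" "v \<kappa> = w \<kappa>"
  shows "v = w"
  by (rule trans[OF sym[OF tangent_of_component[OF assms(1,3,4)]]])
     (unfold assms(5), rule tangent_of_component[OF assms(2-4)])

lemma tangent_of_change:
  assumes "\<kappa> \<in> C" "\<kappa>' \<in> C" "p \<in> fst \<kappa>" "p \<in> fst \<kappa>'"
  shows "tangent_of C \<kappa> p e = tangent_of C \<kappa>' p (jacobian \<kappa> \<kappa>' p e)"
  using assms by (auto simp: tangent_of_def fun_eq_iff jacobian_cocycle)

lemma linear_tangent_of:
  assumes "\<kappa> \<in> C" "p \<in> fst \<kappa>"
  shows "linear (tangent_of C \<kappa> p)"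
  using assms
  by (intro linearI) (auto simp: tangent_of_def fun_eq_iff linear_jacobian linear_add linear_scale)

end

section \<open>Covariant tensors at a point\<close>

text \<open>The tensor product of the coordinate differentials selected by \<open>I\<close>; the
  cutoff to 0 is the normalisation demanded by \<open>cotensors\<close>.\<close>

definition dual_cotensor ::
  "('m, real^'n) chart set \<Rightarrow> ('m, real^'n) chart \<Rightarrow> 'm \<Rightarrow> ('q \<Rightarrow> 'n) \<Rightarrow> ('m, 'n::finite, 'q::finite) cotensor" where
  "dual_cotensor A \<kappa> p I =
     (\<lambda>vs. if range vs \<subseteq> tangent_space A p then \<Prod>a\<in>UNIV. vs a \<kappa> $ I a else 0)"

text \<open>The chart-free form of the fibre block of the complete lift: with \<open>G\<close> equal
  to \<open>\<phi> p\<close> and \<open>a\<close> the first slot it is precomposition with \<phi> in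
  that slot.\<close>

definition pull_slot ::
  "('m, real^'n) chart set \<Rightarrow> 'm \<Rightarrow> 'q \<Rightarrow> (('m, real^'n) tangent \<Rightarrow> ('m, real^'n) tangent) \<Rightarrow>
   ('m, 'n::finite, 'q::finite) cotensor \<Rightarrow> ('m, 'n, 'q) cotensor" where
  "pull_slot A p a G t =
     (\<lambda>vs. if range vs \<subseteq> tangent_space A p then t (vs(a := G (vs a))) else 0)"

lemma cotensorsI:
  assumes "\<And>vs. \<not> range vs \<subseteq> tangent_space A p \<Longrightarrow> t vs = 0"
    and "\<And>vs a v w. range vs \<subseteq> tangent_space A p \<Longrightarrow> v \<in> tangent_space A p \<Longrightarrow> w \<in> tangent_space A p \<Longrightarrow>
      t (vs(a := v + w)) = t (vs(a := v)) + t (vs(a := w))"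
    and "\<And>vs a c v. range vs \<subseteq> tangent_space A p \<Longrightarrow> v \<in> tangent_space A p \<Longrightarrow>
      t (vs(a := c *\<^sub>R v)) = c * t (vs(a := v))"
  shows "t \<in> cotensors A p"
  unfolding cotensors_def
  by (intro CollectI conjI allI impI ballI)
     (erule assms(1), rule assms(2), assumption+, rule assms(3), assumption+)

lemma cotensorsD:
  assumes "t \<in> cotensors A p"
  shows "\<not> range vs \<subseteq> tangent_space A p \<Longrightarrow> t vs = 0"
    and "range vs \<subseteq> tangent_space A p \<Longrightarrow> v \<in> tangent_space A p \<Longrightarrow> w \<in> tangent_space A p \<Longrightarrow>
      t (vs(a := v + w)) = t (vs(a := v)) + t (vs(a := w))"
    and "range vs \<subseteq> tangent_space A p \<Longrightarrow> v \<in> tangent_space A p \<Longrightarrow>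
      t (vs(a := c *\<^sub>R v)) = c * t (vs(a := v))"
  using assms unfolding cotensors_def mem_Collect_eq by (blast, presburger, presburger)

lemma subspace_cotensors: "subspace (cotensors A p)"
  unfolding subspace_def
proof (intro conjI ballI allI)
  show "0 \<in> cotensors A p"
    by (rule cotensorsI) simp_all
  show "s + t \<in> cotensors A p" if "s \<in> cotensors A p" "t \<in> cotensors A p" for s t
    by (rule cotensorsI) (simp_all add: cotensorsD[OF that(1)] cotensorsD[OF that(2)] algebra_simps)
  show "c *\<^sub>R t \<in> cotensors A p" if "t \<in> cotensors A p" for c t
    by (rule cotensorsI) (simp_all add: cotensorsD[OF that] algebra_simps)
qed

lemma pull_slot_linear: "linear (pull_slot A p a G)"
  by (intro linearI) (simp_all add: pull_slot_def fun_eq_iff)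

text \<open>Two applications put \<open>G (G v) = - v\<close> into slot \<open>a\<close>, and
  multilinearity moves the sign out of the tensor.\<close>

lemma pull_slot_pull_slot:
  assumes G: "linear_endo (tangent_space A p) G"
    and GG: "\<And>v. v \<in> tangent_space A p \<Longrightarrow> G (G v) = - v"
    and t: "t \<in> cotensors A p"
  shows "pull_slot A p a G (pull_slot A p a G t) = - t"
proof
  fix vs
  show "pull_slot A p a G (pull_slot A p a G t) vs = (- t) vs"
  proof (cases "range vs \<subseteq> tangent_space A p")
    case True
    then have va: "vs a \<in> tangent_space A p"
      by blast
    then have "G (vs a) \<in> tangent_space A p"
      using G by (simp add: linear_endo_def)
    then have "pull_slot A p a G (pull_slot A p a G t) vs = t (vs(a := G (G (vs a))))"
      using True by (simp add: pull_slot_def range_fun_upd_subset fun_upd_apply[of _ _ _ a] del: fun_upd_apply)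
    \<comment> \<open>The negative is written as a scalar multiple so that homogeneity in slot
      \<open>a\<close> applies.\<close>
    also have "\<dots> = t (vs(a := (- 1) *\<^sub>R vs a))"
      using GG[OF va] by simp
    also have "\<dots> = - t vs"
      using cotensorsD(3)[OF t True va, of a "- 1"] by simp
    finally show ?thesis by simp
  next
    case False
    then show ?thesis
      using cotensorsD(1)[OF t] by (simp add: pull_slot_def)
  qed
qed

section \<open>Expansion of vectors and covariant tensors in the frames of a chart\<close>

locale atlas =
  fixes A :: "('m, real^'n::finite) chart set"
  assumes atlas: "smooth_atlas A"
begin

sublocale differentiable_atlas A
proof
  fix \<kappa> \<kappa>' p
  assume \<kappa>: "\<kappa> \<in> A"
  show "inj_on (snd \<kappa>) (fst \<kappa>)"
    using atlas \<kappa> by (simp add: smooth_atlas_def)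
  assume \<kappa>': "\<kappa>' \<in> A"
  show "open (snd \<kappa> ` (fst \<kappa> \<inter> fst \<kappa>'))"
    using atlas \<kappa> \<kappa>' unfolding smooth_atlas_def by blast
  assume "p \<in> fst \<kappa>" "p \<in> fst \<kappa>'"
  then have "snd \<kappa> p \<in> snd \<kappa> ` (fst \<kappa> \<inter> fst \<kappa>')"
    by blast
  moreover have "smooth_on (snd \<kappa> ` (fst \<kappa> \<inter> fst \<kappa>')) (transition \<kappa> \<kappa>')"
    using atlas \<kappa> \<kappa>' unfolding smooth_atlas_def by blast
  ultimately show "transition \<kappa> \<kappa>' differentiable (at (snd \<kappa> p))"
    by (rule smooth_on_differentiable[rotated])
qed

lemmas tangent_add = subspace_add[OF subspace_tangent_space]
lemmas tangent_scale = subspace_scale[OF subspace_tangent_space]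

lemma jacobian_differentiable:
  assumes "\<kappa> \<in> A" "\<kappa>' \<in> A" "p \<in> fst \<kappa>" "p \<in> fst \<kappa>'"
  shows "(\<lambda>y. frechet_derivative (transition \<kappa> \<kappa>') (at y) e) differentiable (at (snd \<kappa> p))"
proof (rule smooth_on_derivative_differentiable)
  show "smooth_on (snd \<kappa> ` (fst \<kappa> \<inter> fst \<kappa>')) (transition \<kappa> \<kappa>')"
    using atlas assms(1,2) unfolding smooth_atlas_def by blast
qed (use assms in blast)

lemma natural_frame_in:
  "\<kappa> \<in> A \<Longrightarrow> p \<in> fst \<kappa> \<Longrightarrow> natural_frame A \<kappa> p j \<in> tangent_space A p"
  by (simp add: natural_frame_def tangent_of_in)

lemma natural_frame_apply:
  "\<kappa> \<in> A \<Longrightarrow> p \<in> fst \<kappa> \<Longrightarrow> natural_frame A \<kappa> p j \<kappa> = axis j 1"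
  by (simp add: natural_frame_def)

lemma range_natural_frame:
  "\<kappa> \<in> A \<Longrightarrow> p \<in> fst \<kappa> \<Longrightarrow> range (\<lambda>a. natural_frame A \<kappa> p (J a)) \<subseteq> tangent_space A p"
  using natural_frame_in by blast

lemma tangent_expansion:
  assumes "\<kappa> \<in> A" "p \<in> fst \<kappa>" "w \<in> tangent_space A p"
  shows "w = (\<Sum>j\<in>UNIV. w \<kappa> $ j *\<^sub>R natural_frame A \<kappa> p j)"
proof (rule tangent_eqI[OF assms(3) _ assms(1,2)])
  show "(\<Sum>j\<in>UNIV. w \<kappa> $ j *\<^sub>R natural_frame A \<kappa> p j) \<in> tangent_space A p"
    by (intro subspace_sum subspace_tangent_space tangent_scale natural_frame_in assms)
  show "w \<kappa> = (\<Sum>j\<in>UNIV. w \<kappa> $ j *\<^sub>R natural_frame A \<kappa> p j) \<kappa>"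
    unfolding sum_fun_apply scaleR_fun_apply natural_frame_apply[OF assms(1,2)]
    by (rule vec_eq_sum_axis)
qed

lemma dual_cotensor_in: "dual_cotensor A \<kappa> p I \<in> cotensors A p"
  by (rule cotensorsI)
     (simp_all add: dual_cotensor_def range_fun_upd_subset tangent_add tangent_scale
        prod_fun_upd[where g = "\<lambda>b v. v \<kappa> $ I b"] algebra_simps del: fun_upd_apply)

lemma pull_slot_in:
  assumes G: "linear_endo (tangent_space A p) G" and t: "t \<in> cotensors A p"
  shows "pull_slot A p a G t \<in> cotensors A p"
proof (rule cotensorsI)
  let ?T = "tangent_space A p"
  have GT: "G v \<in> ?T" and Gadd: "w \<in> ?T \<Longrightarrow> G (v + w) = G v + G w"
    and Gscale: "G (c *\<^sub>R v) = c *\<^sub>R G v" if "v \<in> ?T" for v w c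
    using G that unfolding linear_endo_def by blast+
  fix vs :: "'a \<Rightarrow> ('m, real^'n) tangent" and b
  show "pull_slot A p a G t vs = 0" if "\<not> range vs \<subseteq> ?T"
    using that by (simp add: pull_slot_def)
  assume vs: "range vs \<subseteq> ?T"
  have vsa: "G (vs a) \<in> ?T"
    using vs GT by blast
  \<comment> \<open>Linearity in slot \<open>b\<close> splits into two cases. For
    \<open>b = a\<close> it combines linearity of \<open>G\<close> with that of \<open>t\<close>;
    otherwise the two updates commute and it is linearity of \<open>t\<close> at the family already
    modified in slot \<open>a\<close>.\<close>
  have swap: "vs(b := x, a := y) = vs(a := y, b := x)" if "b \<noteq> a" for x y
    using that by (rule fun_upd_twist)
  fix v assume v: "v \<in> ?T"
  show "pull_slot A p a G t (vs(b := v + w)) =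
      pull_slot A p a G t (vs(b := v)) + pull_slot A p a G t (vs(b := w))" if w: "w \<in> ?T" for w
    using vs v w vsa
    by (cases "b = a")
       (simp_all add: pull_slot_def range_fun_upd_subset tangent_add Gadd GT swap cotensorsD[OF t]
          fun_upd_apply[of _ _ _ a] del: fun_upd_apply)
  show "pull_slot A p a G t (vs(b := c *\<^sub>R v)) = c * pull_slot A p a G t (vs(b := v))" for c
    using vs v vsa
    by (cases "b = a")
       (simp_all add: pull_slot_def range_fun_upd_subset tangent_scale Gscale GT swap cotensorsD[OF t]
          fun_upd_apply[of _ _ _ a] del: fun_upd_apply)
qed

lemma cotensor_sum_slot:
  assumes t: "t \<in> cotensors A p" and vs: "range vs \<subseteq> tangent_space A p"
    and "\<And>i. i \<in> I \<Longrightarrow> f i \<in> tangent_space A p"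
  shows "t (vs(a := (\<Sum>i\<in>I. c i *\<^sub>R f i))) = (\<Sum>i\<in>I. c i * t (vs(a := f i)))"
proof -
  \<comment> \<open>Covers the sums without terms: the empty one and, by convention, those over
    infinite sets.\<close>
  have zero: "t (vs(a := 0)) = 0"
    using cotensorsD(3)[OF t vs subspace_0[OF subspace_tangent_space], of a 0] by simp
  show ?thesis
    using assms(3)
    by (induction I rule: infinite_finite_induct)
       (simp_all add: zero cotensorsD[OF t] vs tangent_scale subspace_sum[OF subspace_tangent_space])
qed

text \<open>Multilinear expansion, one slot at a time: the induction is over a finite set
  \<open>S\<close> outside which all slots hold frame vectors. Expanding the vector in slot
  \<open>a\<close> in the natural frame removes \<open>a\<close> from \<open>S\<close>; for empty
  \<open>S\<close> the value of \<open>t\<close> is a component.\<close>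

lemma cotensor_eq_0I:
  fixes t :: "('m, 'n, 'q::finite) cotensor"
  assumes \<kappa>: "\<kappa> \<in> A" "p \<in> fst \<kappa>" and t: "t \<in> cotensors A p"
    and comp: "\<And>J. cotensor_comp A \<kappa> p t J = 0"
  shows "t = 0"
proof
  fix vs :: "'q \<Rightarrow> ('m, real^'n) tangent"
  let ?nf = "natural_frame A \<kappa> p"
  have "t vs = 0" if "range vs \<subseteq> tangent_space A p" "\<forall>a. a \<notin> S \<longrightarrow> vs a \<in> range ?nf"
    for S :: "'q set" and vs
    using finite[of S] that
  proof (induction S arbitrary: vs)
    case empty
    then have "\<forall>a. \<exists>j. vs a = ?nf j"
      by blast
    then obtain J where "vs = (\<lambda>a. ?nf (J a))"
      by metis
    then show ?case
      using comp by (simp add: cotensor_comp_def)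
  next
    case (insert a S)
    have "t (vs(a := ?nf j)) = 0" for j
      using insert.prems natural_frame_in[OF \<kappa>] by (intro insert.IH range_fun_upd_subset) auto
    then have "t (vs(a := (\<Sum>j\<in>UNIV. vs a \<kappa> $ j *\<^sub>R ?nf j))) = 0"
      using natural_frame_in[OF \<kappa>] by (subst cotensor_sum_slot[OF t insert.prems(1)]) auto
    moreover have "(\<Sum>j\<in>UNIV. vs a \<kappa> $ j *\<^sub>R ?nf j) = vs a"
      by (rule tangent_expansion[OF \<kappa>, symmetric]) (use insert.prems(1) in blast)
    ultimately show ?case
      by simp
  qed
  then show "t vs = 0 vs"
    using cotensorsD(1)[OF t, of vs] by (cases "range vs \<subseteq> tangent_space A p") auto
qed

lemma cotensor_eqI:
  fixes s t :: "('m, 'n, 'q::finite) cotensor"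
  assumes "\<kappa> \<in> A" "p \<in> fst \<kappa>" "s \<in> cotensors A p" "t \<in> cotensors A p"
    and "\<And>J. cotensor_comp A \<kappa> p s J = cotensor_comp A \<kappa> p t J"
  shows "s = t"
proof -
  have "s - t = 0"
    using assms by (intro cotensor_eq_0I subspace_diff[OF subspace_cotensors])
      (auto simp: cotensor_comp_def)
  then show ?thesis by simp
qed

lemma dual_cotensor_comp:
  assumes "\<kappa> \<in> A" "p \<in> fst \<kappa>"
  shows "cotensor_comp A \<kappa> p (dual_cotensor A \<kappa> p I) J = (if I = J then 1 else 0)"
  using range_natural_frame[OF assms, of J]
  by (auto simp: cotensor_comp_def dual_cotensor_def natural_frame_apply[OF assms] axis_def fun_eq_iff)

text \<open>Supplies the inverse of a bundle chart on each fibre.\<close>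

definition cotensor_of :: "('m, real^'n) chart \<Rightarrow> 'm \<Rightarrow> real^('q \<Rightarrow> 'n) \<Rightarrow> ('m, 'n, 'q::finite) cotensor" where
  "cotensor_of \<kappa> p s = (\<Sum>I\<in>UNIV. s $ I *\<^sub>R dual_cotensor A \<kappa> p I)"

lemma cotensor_of_in: "cotensor_of \<kappa> p s \<in> cotensors A p"
  unfolding cotensor_of_def
  by (intro subspace_sum subspace_cotensors subspace_scale dual_cotensor_in)

lemma comp_cotensor_of:
  assumes "\<kappa> \<in> A" "p \<in> fst \<kappa>"
  shows "cotensor_comp A \<kappa> p (cotensor_of \<kappa> p s) J = s $ J"
proof -
  have "cotensor_comp A \<kappa> p (cotensor_of \<kappa> p s) J =
      (\<Sum>I\<in>UNIV. s $ I * cotensor_comp A \<kappa> p (dual_cotensor A \<kappa> p I) J)"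
    by (simp add: cotensor_comp_def cotensor_of_def sum_fun_apply)
  then show ?thesis
    by (simp add: dual_cotensor_comp[OF assms] if_distrib[of "\<lambda>x. _ * x"] cong: if_cong)
qed

lemma cotensor_expansion:
  assumes "\<kappa> \<in> A" "p \<in> fst \<kappa>" "t \<in> cotensors A p"
  shows "t = (\<Sum>I\<in>UNIV. cotensor_comp A \<kappa> p t I *\<^sub>R dual_cotensor A \<kappa> p I)"
proof -
  have "t = cotensor_of \<kappa> p (\<chi> I. cotensor_comp A \<kappa> p t I)"
    using assms by (intro cotensor_eqI[OF assms(1,2)] cotensor_of_in) (simp_all add: comp_cotensor_of)
  then show ?thesis by (simp add: cotensor_of_def)
qed

section \<open>Charts of the tensor bundle\<close>

lemma snd_bundle_chart:
  "snd (bundle_chart A \<kappa>) (p, t) = (snd \<kappa> p, \<chi> J. cotensor_comp A \<kappa> p t J)"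
  by (simp add: bundle_chart_def)

lemma mem_bundle_chart:
  "(p, t) \<in> fst (bundle_chart A \<kappa>) \<longleftrightarrow> p \<in> fst \<kappa> \<and> t \<in> cotensors A p"
  by (simp add: bundle_chart_def)

lemma inj_bundle_chart:
  assumes "\<kappa> \<in> A"
  shows "inj_on (snd (bundle_chart A \<kappa>)) (fst (bundle_chart A \<kappa>))"
proof (rule inj_onI)
  fix u v
  assume u: "u \<in> fst (bundle_chart A \<kappa>)" and v: "v \<in> fst (bundle_chart A \<kappa>)"
    and eq: "snd (bundle_chart A \<kappa>) u = snd (bundle_chart A \<kappa>) v"
  obtain p s q t where uv: "u = (p, s)" "v = (q, t)"
    by (metis prod.exhaust)
  have "p = q"
    using chart_inj[OF assms] u v eq by (auto simp: uv mem_bundle_chart snd_bundle_chart dest: inj_onD)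
  moreover have "s = t"
    using u v eq \<open>p = q\<close> by (intro cotensor_eqI[OF assms])
      (auto simp: uv mem_bundle_chart snd_bundle_chart vec_eq_iff)
  ultimately show "u = v"
    by (simp add: uv)
qed

lemma bundle_chart_cotensor_of:
  assumes "\<kappa> \<in> A" "p \<in> fst \<kappa>"
  shows "snd (bundle_chart A \<kappa>) (p, cotensor_of \<kappa> p s) = (snd \<kappa> p, s)"
  by (simp add: snd_bundle_chart comp_cotensor_of[OF assms])

text \<open>Every component array is attained by some tensor through \<open>cotensor_of\<close>, so
  the whole fibre model appears; the product form makes the overlap open.\<close>

lemma bundle_overlap:
  fixes \<kappa> \<kappa>' :: "('m, real^'n) chart"
  assumes "\<kappa> \<in> A"
  shows "snd (bundle_chart A \<kappa>) ` (fst (bundle_chart A \<kappa>) \<inter> fst (bundle_chart A \<kappa>')) =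
    (snd \<kappa> ` (fst \<kappa> \<inter> fst \<kappa>')) \<times> (UNIV :: (real^('q::finite \<Rightarrow> 'n)) set)"
proof (intro equalityI subsetI)
  fix z assume "z \<in> (snd \<kappa> ` (fst \<kappa> \<inter> fst \<kappa>')) \<times> (UNIV :: (real^('q \<Rightarrow> 'n)) set)"
  then obtain p s where p: "p \<in> fst \<kappa>" "p \<in> fst \<kappa>'" and z: "z = (snd \<kappa> p, s)"
    by auto
  show "z \<in> snd (bundle_chart A \<kappa>) ` (fst (bundle_chart A \<kappa>) \<inter> fst (bundle_chart A \<kappa>'))"
    unfolding z bundle_chart_cotensor_of[OF assms p(1), symmetric]
    using p cotensor_of_in by (intro imageI) (simp add: mem_bundle_chart)
qed (auto simp: mem_bundle_chart snd_bundle_chart)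

text \<open>The covariant transformation law. The Jacobian runs from \<open>\<kappa>'\<close> back
  to \<open>\<kappa>\<close> because the new components evaluate the tensor on the frame of
  \<open>\<kappa>'\<close>, whose vectors must be expressed in \<open>\<kappa>\<close>.\<close>

lemma bundle_transition:
  assumes "\<kappa> \<in> A" "\<kappa>' \<in> A" "p \<in> fst \<kappa>" "p \<in> fst \<kappa>'"
  shows "transition (bundle_chart A \<kappa>) (bundle_chart A \<kappa>') (snd \<kappa> p, s :: real^('q::finite \<Rightarrow> 'n)) =
    (snd \<kappa>' p, \<chi> K. \<Sum>I\<in>UNIV. s $ I * (\<Prod>a\<in>UNIV. jacobian \<kappa>' \<kappa> p (axis (K a) 1) $ I a))"
proof -
  have nf: "natural_frame A \<kappa>' p k \<kappa> = jacobian \<kappa>' \<kappa> p (axis k 1)" for k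
    using assms by (simp add: natural_frame_def tangent_of_def)
  have "inv_into (fst (bundle_chart A \<kappa>)) (snd (bundle_chart A \<kappa>)) (snd \<kappa> p, s) = (p, cotensor_of \<kappa> p s)"
    using inv_into_f_f[OF inj_bundle_chart[OF assms(1)], of "(p, cotensor_of \<kappa> p s)"] assms(3)
    by (simp add: bundle_chart_cotensor_of[OF assms(1,3)] mem_bundle_chart cotensor_of_in)
  then have "transition (bundle_chart A \<kappa>) (bundle_chart A \<kappa>') (snd \<kappa> p, s) =
      (snd \<kappa>' p, \<chi> K. cotensor_comp A \<kappa>' p (cotensor_of \<kappa> p s) K)"
    by (simp add: transition_def snd_bundle_chart)
  moreover have "cotensor_comp A \<kappa>' p (cotensor_of \<kappa> p s) K =
      (\<Sum>I\<in>UNIV. s $ I * (\<Prod>a\<in>UNIV. jacobian \<kappa>' \<kappa> p (axis (K a) 1) $ I a))" for K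
    using range_natural_frame[OF assms(2,4), of K]
    by (simp add: cotensor_comp_def cotensor_of_def sum_fun_apply dual_cotensor_def nf)
  ultimately show ?thesis by simp
qed

lemma bundle_transition_differentiable:
  fixes s :: "real^('q::finite \<Rightarrow> 'n)"
  assumes \<kappa>: "\<kappa> \<in> A" "\<kappa>' \<in> A" "p \<in> fst \<kappa>" "p \<in> fst \<kappa>'"
  shows "transition (bundle_chart A \<kappa>) (bundle_chart A \<kappa>') differentiable (at (snd \<kappa> p, s))"
proof -
  \<comment> \<open>The Jacobian is taken at a point in \<open>\<kappa>'\<close>-coordinates;
    composing with the base transition makes it a function of the source coordinates
    \<open>z\<close>.\<close>
  define D where "D e z = frechet_derivative (transition \<kappa>' \<kappa>) (at (transition \<kappa> \<kappa>' (fst z))) e"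
    for e and z :: "('n, 'q) bundle_model"
  define g where "g z = (transition \<kappa> \<kappa>' (fst z),
      \<chi> K. \<Sum>I\<in>UNIV. snd z $ I * (\<Prod>a\<in>UNIV. D (axis (K a) 1) z $ I a))"
    for z :: "('n, 'q) bundle_model"
  have base: "(\<lambda>z::('n, 'q) bundle_model. transition \<kappa> \<kappa>' (fst z)) differentiable (at (snd \<kappa> p, s))"
    by (rule differentiable_compose)
       (simp_all add: transition_differentiable \<kappa> bounded_linear_imp_differentiable bounded_linear_fst)
  have "D e differentiable (at (snd \<kappa> p, s))" for e
    unfolding D_def
    by (rule differentiable_compose[OF _ base])
       (simp add: transition_chart \<kappa> jacobian_differentiable)
  then have D: "(\<lambda>z. D e z $ i) differentiable (at (snd \<kappa> p, s))" for e i
    by (rule differentiable_compose[rotated])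
       (simp add: bounded_linear_imp_differentiable bounded_linear_vec_nth)
  have S: "(\<lambda>z::('n, 'q) bundle_model. snd z $ I) differentiable (at (snd \<kappa> p, s))" for I
    by (intro bounded_linear_imp_differentiable bounded_linear_compose[OF bounded_linear_vec_nth]
          bounded_linear_snd)
  have "g differentiable (at (snd \<kappa> p, s))"
    unfolding g_def
    by (intro differentiable_Pair_at base differentiable_vec_lambda differentiable_sum ballI
          differentiable_mult differentiable_prod_real S D) simp
  then obtain G where G: "(g has_derivative G) (at (snd \<kappa> p, s))"
    by (auto simp: differentiable_def)
  \<comment> \<open>The explicit formula \<open>g\<close> describes the transition only on the
    overlap, which is an open product set.\<close>
  have "(transition (bundle_chart A \<kappa>) (bundle_chart A \<kappa>') has_derivative G) (at (snd \<kappa> p, s))"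
  proof (rule has_derivative_transform_within_open[OF G])
    show "open ((snd \<kappa> ` (fst \<kappa> \<inter> fst \<kappa>')) \<times> (UNIV :: (real^('q \<Rightarrow> 'n)) set))"
      using \<kappa> by (intro open_Times overlap_open) auto
    show "(snd \<kappa> p, s) \<in> (snd \<kappa> ` (fst \<kappa> \<inter> fst \<kappa>')) \<times> UNIV"
      using \<kappa> by auto
    fix z :: "('n, 'q) bundle_model"
    assume "z \<in> (snd \<kappa> ` (fst \<kappa> \<inter> fst \<kappa>')) \<times> UNIV"
    then obtain q r where q: "q \<in> fst \<kappa>" "q \<in> fst \<kappa>'" and z: "z = (snd \<kappa> q, r)"
      by auto
    show "g z = transition (bundle_chart A \<kappa>) (bundle_chart A \<kappa>') z"
      unfolding z bundle_transition[OF \<kappa>(1,2) q] by (simp add: g_def D_def transition_chart \<kappa> q)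
  qed
  then show ?thesis
    by (auto simp: differentiable_def)
qed

lemma differentiable_atlas_tensor_bundle:
  "differentiable_atlas (tensor_bundle A ::
     (('m, 'n, 'q::finite) bundle_point, ('n, 'q) bundle_model) chart set)"
proof
  fix c c' :: "(('m, 'n, 'q) bundle_point, ('n, 'q) bundle_model) chart" and u
  assume "c \<in> tensor_bundle A"
  then obtain \<kappa> where \<kappa>: "\<kappa> \<in> A" "c = bundle_chart A \<kappa>"
    by (auto simp: tensor_bundle_def)
  show "inj_on (snd c) (fst c)"
    using \<kappa> inj_bundle_chart by simp
  assume "c' \<in> tensor_bundle A"
  then obtain \<kappa>' where \<kappa>': "\<kappa>' \<in> A" "c' = bundle_chart A \<kappa>'"
    by (auto simp: tensor_bundle_def)
  show "open (snd c ` (fst c \<inter> fst c'))"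
    using \<kappa> \<kappa>' overlap_open by (simp add: bundle_overlap open_Times)
  assume "u \<in> fst c" "u \<in> fst c'"
  then show "transition c c' differentiable (at (snd c u))"
    using \<kappa> \<kappa>' by (cases u)
      (simp add: mem_bundle_chart snd_bundle_chart bundle_transition_differentiable)
qed

end

section \<open>Tangent spaces along a section\<close>

locale cotensor_section = atlas A
  for A :: "('m, real^'n::finite) chart set" +
  fixes \<xi> :: "'m \<Rightarrow> ('m, 'n, 'q::{finite,linorder}) cotensor"
  assumes section_field: "cotensor_field A \<xi>"
begin

abbreviation TB :: "(('m, 'n, 'q) bundle_point, ('n, 'q) bundle_model) chart set" where
  "TB \<equiv> tensor_bundle A"

abbreviation bc :: "('m, real^'n) chart \<Rightarrow> (('m, 'n, 'q) bundle_point, ('n, 'q) bundle_model) chart" where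
  "bc \<equiv> bundle_chart A"

sublocale tb: differentiable_atlas TB
  by (rule differentiable_atlas_tensor_bundle)

lemma section_in: "\<kappa> \<in> A \<Longrightarrow> p \<in> fst \<kappa> \<Longrightarrow> \<xi> p \<in> cotensors A p"
  using section_field unfolding cotensor_field_def points_def by blast

lemma bc_in: "\<kappa> \<in> A \<Longrightarrow> bc \<kappa> \<in> TB"
  by (simp add: tensor_bundle_def)

lemma section_in_bc: "\<kappa> \<in> A \<Longrightarrow> p \<in> fst \<kappa> \<Longrightarrow> (p, \<xi> p) \<in> fst (bc \<kappa>)"
  by (simp add: mem_bundle_chart section_in)

text \<open>The differential of the section in the charts \<open>\<kappa>\<close> and
  \<open>bc \<kappa>\<close>; its values on the axis vectors are the components of the fields
  \<open>B_frame\<close>.\<close>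

definition dsection :: "('m, real^'n) chart \<Rightarrow> 'm \<Rightarrow> real^'n \<Rightarrow> ('n, 'q) bundle_model" where
  "dsection \<kappa> p e =
     (e, \<chi> K. frechet_derivative (in_chart \<kappa> (field_comp A \<xi> \<kappa> K)) (at (snd \<kappa> p)) e)"

lemma section_has_derivative:
  assumes "\<kappa> \<in> A" "p \<in> fst \<kappa>"
  shows "((\<lambda>y. (y, \<chi> K. in_chart \<kappa> (field_comp A \<xi> \<kappa> K) y)) has_derivative dsection \<kappa> p) (at (snd \<kappa> p))"
proof -
  have "in_chart \<kappa> (field_comp A \<xi> \<kappa> K) differentiable (at (snd \<kappa> p))" for K
  proof (rule smooth_on_differentiable)
    show "smooth_on (snd \<kappa> ` fst \<kappa>) (in_chart \<kappa> (field_comp A \<xi> \<kappa> K))"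
      using section_field assms(1) by (simp add: cotensor_field_def)
  qed (use assms in blast)
  then show ?thesis
    unfolding dsection_def[abs_def]
    by (intro has_derivative_Pair has_derivative_ident has_derivative_vec_lambda)
      (simp add: frechet_derivative_works)
qed

lemma linear_dsection: "\<kappa> \<in> A \<Longrightarrow> p \<in> fst \<kappa> \<Longrightarrow> linear (dsection \<kappa> p)"
  using section_has_derivative has_derivative_linear by blast

section \<open>Change of charts for vectors tangent to the section and for vertical vectors\<close>

lemma section_chart:
  assumes "\<kappa> \<in> A" "p \<in> fst \<kappa>"
  shows "(snd \<kappa> p, \<chi> K. in_chart \<kappa> (field_comp A \<xi> \<kappa> K) (snd \<kappa> p)) = snd (bc \<kappa>) (p, \<xi> p)"
  using assms by (simp add: snd_bundle_chart in_chart_chart field_comp_def)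

text \<open>Both sides differentiate the same local map: the section in \<open>\<kappa>\<close>
  followed by the bundle transition is the base transition followed by the section in
  \<open>\<kappa>'\<close>. Hence the differential of the section does not depend on the
  chart.\<close>

lemma bundle_jacobian_dsection:
  assumes \<kappa>: "\<kappa> \<in> A" "\<kappa>' \<in> A" "p \<in> fst \<kappa>" "p \<in> fst \<kappa>'"
  shows "tb.jacobian (bc \<kappa>) (bc \<kappa>') (p, \<xi> p) (dsection \<kappa> p e) = dsection \<kappa>' p (jacobian \<kappa> \<kappa>' p e)"
proof -
  let ?s = "\<lambda>\<kappa> y. (y, \<chi> K. in_chart \<kappa> (field_comp A \<xi> \<kappa> K) y)"
  let ?f = "transition (bc \<kappa>) (bc \<kappa>')"
  have "(?f has_derivative tb.jacobian (bc \<kappa>) (bc \<kappa>') (p, \<xi> p)) (at (?s \<kappa> (snd \<kappa> p)))"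
    unfolding section_chart[OF \<kappa>(1,3)]
    by (intro tb.jacobian_has_derivative bc_in section_in_bc \<kappa>)
  from diff_chain_at[OF section_has_derivative[OF \<kappa>(1,3)] this]
  have "(tb.jacobian (bc \<kappa>) (bc \<kappa>') (p, \<xi> p) \<circ> dsection \<kappa> p) e = dsection \<kappa>' p (jacobian \<kappa> \<kappa>' p e)"
  proof (rule jacobian_chain[OF \<kappa> _ section_has_derivative[OF \<kappa>(2,4)]])
    show "open (snd \<kappa> ` (fst \<kappa> \<inter> fst \<kappa>'))"
      using \<kappa> overlap_open by blast
    show "snd \<kappa> p \<in> snd \<kappa> ` (fst \<kappa> \<inter> fst \<kappa>')"
      using \<kappa> by blast
    fix y assume "y \<in> snd \<kappa> ` (fst \<kappa> \<inter> fst \<kappa>')"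
    then obtain q where q: "q \<in> fst \<kappa>" "q \<in> fst \<kappa>'" and y: "y = snd \<kappa> q"
      by auto
    have "?f (?s \<kappa> y) = snd (bc \<kappa>') (q, \<xi> q)"
      unfolding y section_chart[OF \<kappa>(1) q(1)]
      by (intro tb.transition_chart bc_in section_in_bc \<kappa> q)
    then show "(?f \<circ> ?s \<kappa>) y = ?s \<kappa>' (transition \<kappa> \<kappa>' y)"
      unfolding y transition_chart[OF \<kappa>(1) q(1)] section_chart[OF \<kappa>(2) q(2)] by simp
  qed
  then show ?thesis by simp
qed

text \<open>Over the fixed base point \<open>p\<close> the bundle transition is a linear map
  \<open>L\<close> of the fibre, and so equals its own derivative; composing with the inclusion of
  the fibre extracts the vertical part of the Jacobian.\<close>

lemma bundle_jacobian_vertical: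
  assumes \<kappa>: "\<kappa> \<in> A" "\<kappa>' \<in> A" "p \<in> fst \<kappa>" "p \<in> fst \<kappa>'" and t: "t \<in> cotensors A p"
  shows "tb.jacobian (bc \<kappa>) (bc \<kappa>') (p, \<xi> p) (0, \<chi> J. cotensor_comp A \<kappa> p t J) =
    (0, \<chi> J. cotensor_comp A \<kappa>' p t J)"
proof -
  let ?f = "transition (bc \<kappa>) (bc \<kappa>')"
  let ?s0 = "\<chi> J. cotensor_comp A \<kappa> p (\<xi> p) J"
  define L where "L s = (\<chi> K. \<Sum>I\<in>UNIV. s $ I * (\<Prod>a\<in>UNIV. jacobian \<kappa>' \<kappa> p (axis (K a) 1) $ I a))"
    for s :: "real^('q \<Rightarrow> 'n)"
  have f: "?f (snd \<kappa> p, s) = (snd \<kappa>' p, L s)" for s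
    by (simp add: bundle_transition \<kappa> L_def)
  have "(?f has_derivative tb.jacobian (bc \<kappa>) (bc \<kappa>') (p, \<xi> p)) (at (snd \<kappa> p, ?s0))"
    unfolding snd_bundle_chart[symmetric]
    by (intro tb.jacobian_has_derivative bc_in section_in_bc \<kappa>)
  moreover have "((\<lambda>s. (snd \<kappa> p, s)) has_derivative (\<lambda>e. (0, e))) (at ?s0)"
    by (intro has_derivative_Pair has_derivative_const has_derivative_ident)
  ultimately have "((\<lambda>s. (snd \<kappa>' p, L s)) has_derivative
      (\<lambda>e. tb.jacobian (bc \<kappa>) (bc \<kappa>') (p, \<xi> p) (0, e))) (at ?s0)"
    using diff_chain_at[of "\<lambda>s. (snd \<kappa> p, s)" "\<lambda>e. (0, e)" ?s0 ?f] by (simp add: o_def f)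
  moreover have "linear L"
    by (intro linearI) (simp_all add: L_def vec_eq_iff sum.distrib sum_distrib_left algebra_simps)
  then have "((\<lambda>s. (snd \<kappa>' p, L s)) has_derivative (\<lambda>e. (0, L e))) (at ?s0)"
    by (intro has_derivative_Pair has_derivative_const linear_imp_has_derivative)
  ultimately have "(\<lambda>e. tb.jacobian (bc \<kappa>) (bc \<kappa>') (p, \<xi> p) (0, e)) = (\<lambda>e. (0, L e))"
    by (rule has_derivative_unique)
  then have "tb.jacobian (bc \<kappa>) (bc \<kappa>') (p, \<xi> p) (0, e) = (0, L e)" for e
    by meson
  \<comment> \<open>Following the bundle point \<open>(p, t)\<close> itself through the transition
    shows that \<open>L\<close> carries the components of \<open>t\<close> in
    \<open>\<kappa>\<close> to those in \<open>\<kappa>'\<close>.\<close>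
  moreover have "?f (snd (bc \<kappa>) (p, t)) = snd (bc \<kappa>') (p, t)"
    using \<kappa> t by (intro tb.transition_chart bc_in) (simp_all add: mem_bundle_chart)
  then have "L (\<chi> J. cotensor_comp A \<kappa> p t J) = (\<chi> J. cotensor_comp A \<kappa>' p t J)"
    by (simp add: snd_bundle_chart f)
  ultimately show ?thesis by simp
qed

text \<open>The chart serves only to write the vector down; \<open>section_lift_change\<close>, and
  likewise \<open>vertical_lift_change\<close> for the vertical lift, remove the dependence on
  it.\<close>

definition section_lift :: "('m, real^'n) chart \<Rightarrow> 'm \<Rightarrow> ('m, real^'n) tangent \<Rightarrow> ('m, 'n, 'q) bundle_tangent" where
  "section_lift \<kappa> p w = tangent_of TB (bc \<kappa>) (p, \<xi> p) (dsection \<kappa> p (w \<kappa>))"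

definition vertical_lift :: "('m, real^'n) chart \<Rightarrow> 'm \<Rightarrow> ('m, 'n, 'q) cotensor \<Rightarrow> ('m, 'n, 'q) bundle_tangent" where
  "vertical_lift \<kappa> p t = tangent_of TB (bc \<kappa>) (p, \<xi> p) (0, \<chi> J. cotensor_comp A \<kappa> p t J)"

lemma section_lift_change:
  assumes "\<kappa> \<in> A" "\<kappa>' \<in> A" "p \<in> fst \<kappa>" "p \<in> fst \<kappa>'" "w \<in> tangent_space A p"
  shows "section_lift \<kappa> p w = section_lift \<kappa>' p w"
  unfolding section_lift_def
  by (subst tb.tangent_of_change[OF bc_in[OF assms(1)] bc_in[OF assms(2)]
        section_in_bc[OF assms(1,3)] section_in_bc[OF assms(2,4)]])
     (simp_all only: bundle_jacobian_dsection tangent_space_jacobian assms)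

lemma vertical_lift_change:
  assumes "\<kappa> \<in> A" "\<kappa>' \<in> A" "p \<in> fst \<kappa>" "p \<in> fst \<kappa>'" "t \<in> cotensors A p"
  shows "vertical_lift \<kappa> p t = vertical_lift \<kappa>' p t"
  unfolding vertical_lift_def
  by (subst tb.tangent_of_change[OF bc_in[OF assms(1)] bc_in[OF assms(2)]
        section_in_bc[OF assms(1,3)] section_in_bc[OF assms(2,4)]])
     (simp_all only: bundle_jacobian_vertical assms)

lemma B_frame_eq:
  "\<kappa> \<in> A \<Longrightarrow> p \<in> fst \<kappa> \<Longrightarrow> B_frame A \<xi> \<kappa> p l = section_lift \<kappa> p (natural_frame A \<kappa> p l)"
  by (simp add: B_frame_def section_lift_def dsection_def pderiv_chart_def natural_frame_apply)

lemma C_frame_eq: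
  assumes "\<kappa> \<in> A" "p \<in> fst \<kappa>"
  shows "C_frame A \<xi> \<kappa> p R = vertical_lift \<kappa> p (dual_cotensor A \<kappa> p R)"
proof -
  have "(\<chi> J. cotensor_comp A \<kappa> p (dual_cotensor A \<kappa> p R) J) = axis R 1"
    by (auto simp: dual_cotensor_comp[OF assms] axis_def vec_eq_iff)
  then show ?thesis
    by (simp add: C_frame_def vertical_lift_def)
qed

section \<open>Splitting of the tangent space at a point of the section\<close>

context
  fixes \<kappa> p
  assumes \<kappa>: "\<kappa> \<in> A" "p \<in> fst \<kappa>"
begin

lemma section_lift_in: "section_lift \<kappa> p w \<in> tangent_space TB (p, \<xi> p)"
  unfolding section_lift_def by (intro tb.tangent_of_in bc_in section_in_bc \<kappa>)

lemma vertical_lift_in: "vertical_lift \<kappa> p t \<in> tangent_space TB (p, \<xi> p)"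
  unfolding vertical_lift_def by (intro tb.tangent_of_in bc_in section_in_bc \<kappa>)

lemma linear_section_lift: "linear (section_lift \<kappa> p)"
proof -
  have "linear (\<lambda>w::('m, real^'n) tangent. w \<kappa>)"
    by (intro linearI) simp_all
  from linear_compose[OF linear_compose[OF this linear_dsection[OF \<kappa>]]
      tb.linear_tangent_of[OF bc_in[OF \<kappa>(1)] section_in_bc[OF \<kappa>]]]
  show ?thesis
    by (simp add: section_lift_def[abs_def] o_def)
qed

lemma linear_vertical_lift: "linear (vertical_lift \<kappa> p)"
proof -
  have "linear (\<lambda>t. (0 :: real^'n, (\<chi> J. cotensor_comp A \<kappa> p t J) :: real^('q \<Rightarrow> 'n)))"
    by (intro linearI) (simp_all add: cotensor_comp_def vec_eq_iff)
  from linear_compose[OF this tb.linear_tangent_of[OF bc_in[OF \<kappa>(1)] section_in_bc[OF \<kappa>]]]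
  show ?thesis
    by (simp add: vertical_lift_def[abs_def] o_def)
qed

text \<open>The differential of the bundle projection, computed in the chart
  \<open>\<kappa>\<close>.\<close>

definition base_part :: "('m, 'n, 'q) bundle_tangent \<Rightarrow> ('m, real^'n) tangent" where
  "base_part v = tangent_of A \<kappa> p (fst (v (bc \<kappa>)))"

text \<open>Subtracting the image of the base part under the differential of the section leaves a
  vertical vector, which is read as a tensor.\<close>

definition fibre_part :: "('m, 'n, 'q) bundle_tangent \<Rightarrow> ('m, 'n, 'q) cotensor" where
  "fibre_part v = cotensor_of \<kappa> p (snd (v (bc \<kappa>)) - snd (dsection \<kappa> p (fst (v (bc \<kappa>)))))"

lemma base_part_in: "base_part v \<in> tangent_space A p"
  unfolding base_part_def by (intro tangent_of_in \<kappa>)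

lemma fibre_part_in: "fibre_part v \<in> cotensors A p"
  unfolding fibre_part_def by (rule cotensor_of_in)

lemma section_lift_apply: "section_lift \<kappa> p w (bc \<kappa>) = dsection \<kappa> p (w \<kappa>)"
  unfolding section_lift_def by (intro tb.tangent_of_apply bc_in section_in_bc \<kappa>)

lemma vertical_lift_apply: "vertical_lift \<kappa> p t (bc \<kappa>) = (0, \<chi> J. cotensor_comp A \<kappa> p t J)"
  unfolding vertical_lift_def by (intro tb.tangent_of_apply bc_in section_in_bc \<kappa>)

lemma fst_dsection: "fst (dsection \<kappa> p e) = e"
  by (simp add: dsection_def)

lemma lift_parts:
  assumes "v \<in> tangent_space TB (p, \<xi> p)"
  shows "section_lift \<kappa> p (base_part v) + vertical_lift \<kappa> p (fibre_part v) = v"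
proof (rule tb.tangent_eqI[OF _ assms bc_in[OF \<kappa>(1)] section_in_bc[OF \<kappa>]])
  show "section_lift \<kappa> p (base_part v) + vertical_lift \<kappa> p (fibre_part v) \<in> tangent_space TB (p, \<xi> p)"
    by (intro subspace_add tb.subspace_tangent_space section_lift_in vertical_lift_in)
  show "(section_lift \<kappa> p (base_part v) + vertical_lift \<kappa> p (fibre_part v)) (bc \<kappa>) = v (bc \<kappa>)"
    by (simp add: section_lift_apply vertical_lift_apply base_part_def fibre_part_def \<kappa>
        comp_cotensor_of prod_eq_iff vec_eq_iff fst_dsection)
qed

lemma base_part_lift:
  assumes "w \<in> tangent_space A p"
  shows "base_part (section_lift \<kappa> p w + vertical_lift \<kappa> p t) = w"
  by (simp add: base_part_def section_lift_apply vertical_lift_apply fst_dsection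
      tangent_of_component[OF assms \<kappa>])

lemma fibre_part_lift:
  assumes "t \<in> cotensors A p"
  shows "fibre_part (section_lift \<kappa> p w + vertical_lift \<kappa> p t) = t"
  by (simp add: fibre_part_def section_lift_apply vertical_lift_apply fst_dsection
      cotensor_of_def cotensor_expansion[OF \<kappa> assms, symmetric])

lemma linear_base_part: "linear base_part"
  using linear_tangent_of[OF \<kappa>]
  by (intro linearI) (simp_all add: base_part_def linear_add linear_scale)

lemma linear_fibre_part: "linear fibre_part"
proof (intro linearI)
  have "linear (cotensor_of \<kappa> p :: real^('q \<Rightarrow> 'n) \<Rightarrow> _)"
    by (intro linearI) (simp_all add: cotensor_of_def scaleR_left_distrib sum.distrib scaleR_sum_right)
  note lin = linear_add[OF this] linear_diff[OF this] linear_scale[OF this]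
    linear_add[OF linear_dsection[OF \<kappa>]] linear_scale[OF linear_dsection[OF \<kappa>]]
  show "fibre_part (v + w) = fibre_part v + fibre_part w" for v w
    by (simp add: fibre_part_def lin)
  show "fibre_part (c *\<^sub>R v) = c *\<^sub>R fibre_part v" for c v
    by (simp add: fibre_part_def lin scaleR_diff_right)
qed

text \<open>Uniqueness for the complete lift: the splitting shows that the adapted frame of a single
  chart spans the tangent space, and \<open>extensional\<close> fixes the values outside it.\<close>

lemma bundle_endo_eqI:
  assumes F: "linear_endo (tangent_space TB (p, \<xi> p)) F" "F \<in> extensional (tangent_space TB (p, \<xi> p))"
    and G: "linear_endo (tangent_space TB (p, \<xi> p)) G" "G \<in> extensional (tangent_space TB (p, \<xi> p))"
    and B: "\<And>l. F (B_frame A \<xi> \<kappa> p l) = G (B_frame A \<xi> \<kappa> p l)"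
    and C: "\<And>R. F (C_frame A \<xi> \<kappa> p R) = G (C_frame A \<xi> \<kappa> p R)"
  shows "F = G"
proof (rule extensionalityI[OF F(2) G(2)])
  fix v assume v: "v \<in> tangent_space TB (p, \<xi> p)"
  let ?b = "\<Sum>j\<in>UNIV. base_part v \<kappa> $ j *\<^sub>R B_frame A \<xi> \<kappa> p j"
  let ?c = "\<Sum>I\<in>UNIV. cotensor_comp A \<kappa> p (fibre_part v) I *\<^sub>R C_frame A \<xi> \<kappa> p I"
  have B_in: "B_frame A \<xi> \<kappa> p j \<in> tangent_space TB (p, \<xi> p)" for j
    by (simp add: B_frame_eq \<kappa> section_lift_in)
  have C_in: "C_frame A \<xi> \<kappa> p R \<in> tangent_space TB (p, \<xi> p)" for R
    by (simp add: C_frame_eq \<kappa> vertical_lift_in)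
  have b: "section_lift \<kappa> p (base_part v) = ?b"
    by (subst tangent_expansion[OF \<kappa> base_part_in])
       (simp add: linear_sum[OF linear_section_lift] linear_scale[OF linear_section_lift] B_frame_eq \<kappa>)
  have c: "vertical_lift \<kappa> p (fibre_part v) = ?c"
    by (subst cotensor_expansion[OF \<kappa> fibre_part_in])
       (simp add: linear_sum[OF linear_vertical_lift] linear_scale[OF linear_vertical_lift] C_frame_eq \<kappa>)
  have H: "H v = (\<Sum>j\<in>UNIV. base_part v \<kappa> $ j *\<^sub>R H (B_frame A \<xi> \<kappa> p j)) +
      (\<Sum>I\<in>UNIV. cotensor_comp A \<kappa> p (fibre_part v) I *\<^sub>R H (C_frame A \<xi> \<kappa> p I))"
    if H: "linear_endo (tangent_space TB (p, \<xi> p)) H" for H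
  proof -
    have "H (section_lift \<kappa> p (base_part v) + vertical_lift \<kappa> p (fibre_part v)) =
        H (section_lift \<kappa> p (base_part v)) + H (vertical_lift \<kappa> p (fibre_part v))"
      using H section_lift_in vertical_lift_in unfolding linear_endo_def by blast
    then have "H v = H ?b + H ?c"
      unfolding lift_parts[OF v] unfolding b c .
    then show ?thesis
      by (simp add: linear_endo_sum[OF H tb.subspace_tangent_space] B_in C_in)
  qed
  show "F v = G v"
    unfolding H[OF F(1)] H[OF G(1)] B C ..
qed

end

end

section \<open>The complete lift along an almost analytic section\<close>

locale analytic_section = cotensor_section A \<xi>
  for A :: "('m, real^'n::finite) chart set"
    and \<xi> :: "'m \<Rightarrow> ('m, 'n, 'q::{finite,linorder}) cotensor" +
  fixes \<phi> :: "'m \<Rightarrow> ('m, real^'n) tangent \<Rightarrow> ('m, real^'n) tangent"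
  assumes almost_complex: "almost_complex_along A (points A) \<phi>"
    and tachibana_zero: "\<kappa> \<in> A \<Longrightarrow> p \<in> fst \<kappa> \<Longrightarrow> tachibana A \<phi> \<xi> \<kappa> l K p = 0"
begin

abbreviation pull :: "'m \<Rightarrow> ('m, 'n, 'q) cotensor \<Rightarrow> ('m, 'n, 'q) cotensor" where
  "pull p \<equiv> pull_slot A p first_slot (\<phi> p)"

text \<open>The chart-free map with the matrix of the complete lift, restricted to the tangent space
  to meet the condition \<open>extensional\<close> of \<open>is_complete_lift_at\<close>.\<close>

definition lift_endo :: "('m, real^'n) chart \<Rightarrow> 'm \<Rightarrow> ('m, 'n, 'q) bundle_tangent \<Rightarrow> ('m, 'n, 'q) bundle_tangent" where
  "lift_endo \<kappa> p = (\<lambda>v\<in>tangent_space TB (p, \<xi> p).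
     section_lift \<kappa> p (\<phi> p (base_part \<kappa> p v)) + vertical_lift \<kappa> p (pull p (fibre_part \<kappa> p v)))"

context
  fixes \<kappa> p
  assumes \<kappa>: "\<kappa> \<in> A" "p \<in> fst \<kappa>"
begin

lemma p_in_points: "p \<in> points A"
  using \<kappa> by (auto simp: points_def)

lemma \<phi>_endo: "linear_endo (tangent_space A p) (\<phi> p)"
  and \<phi>_\<phi>: "w \<in> tangent_space A p \<Longrightarrow> \<phi> p (\<phi> p w) = - w"
  using almost_complex p_in_points by (auto simp: almost_complex_along_def)

lemma \<phi>_in: "w \<in> tangent_space A p \<Longrightarrow> \<phi> p w \<in> tangent_space A p"
  using \<phi>_endo by (simp add: linear_endo_def)

lemma pull_in: "t \<in> cotensors A p \<Longrightarrow> pull p t \<in> cotensors A p"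
  by (rule pull_slot_in[OF \<phi>_endo])

lemma lift_endo_lift:
  assumes "w \<in> tangent_space A p" "t \<in> cotensors A p"
  shows "lift_endo \<kappa> p (section_lift \<kappa> p w + vertical_lift \<kappa> p t) =
    section_lift \<kappa> p (\<phi> p w) + vertical_lift \<kappa> p (pull p t)"
  using assms subspace_add[OF tb.subspace_tangent_space section_lift_in[OF \<kappa>] vertical_lift_in[OF \<kappa>]]
  by (simp add: lift_endo_def base_part_lift[OF \<kappa>] fibre_part_lift[OF \<kappa>])

lemma lift_endo_linear: "linear_endo (tangent_space TB (p, \<xi> p)) (lift_endo \<kappa> p)"
proof -
  note lin = linear_add linear_scale
  note lin = lin[OF linear_section_lift[OF \<kappa>]] lin[OF linear_vertical_lift[OF \<kappa>]]
    lin[OF linear_base_part[OF \<kappa>]] lin[OF linear_fibre_part[OF \<kappa>]] lin[OF pull_slot_linear]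
  have \<phi>_lin: "w \<in> tangent_space A p \<Longrightarrow> \<phi> p (v + w) = \<phi> p v + \<phi> p w"
      "\<phi> p (c *\<^sub>R v) = c *\<^sub>R \<phi> p v"
    if "v \<in> tangent_space A p" for v w c
    using \<phi>_endo that unfolding linear_endo_def by blast+
  show ?thesis
    unfolding linear_endo_def
    by (simp add: lift_endo_def subspace_add[OF tb.subspace_tangent_space]
        subspace_scale[OF tb.subspace_tangent_space] section_lift_in[OF \<kappa>] vertical_lift_in[OF \<kappa>]
        lin \<phi>_lin base_part_in[OF \<kappa>] scaleR_add_right algebra_simps)
qed

text \<open>The splitting reduces the square to the squares of \<open>\<phi> p\<close> on the base
  part and of \<open>pull p\<close> on the fibre part, both equal to the negative of the
  identity.\<close>

lemma lift_endo_lift_endo: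
  assumes "v \<in> tangent_space TB (p, \<xi> p)"
  shows "lift_endo \<kappa> p (lift_endo \<kappa> p v) = - v"
proof -
  let ?w = "base_part \<kappa> p v" and ?t = "fibre_part \<kappa> p v"
  note [simp] = base_part_in[OF \<kappa>] fibre_part_in[OF \<kappa>] \<phi>_in pull_in
  have "lift_endo \<kappa> p (lift_endo \<kappa> p (section_lift \<kappa> p ?w + vertical_lift \<kappa> p ?t)) =
      section_lift \<kappa> p (- ?w) + vertical_lift \<kappa> p (- ?t)"
    by (simp add: lift_endo_lift \<phi>_\<phi> pull_slot_pull_slot[OF \<phi>_endo \<phi>_\<phi>])
  also have "\<dots> = - (section_lift \<kappa> p ?w + vertical_lift \<kappa> p ?t)"
    by (simp add: linear_neg[OF linear_section_lift[OF \<kappa>]] linear_neg[OF linear_vertical_lift[OF \<kappa>]])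
  finally show ?thesis
    unfolding lift_parts[OF \<kappa> assms] .
qed

lemma \<phi>_natural_frame:
  "\<phi> p (natural_frame A \<kappa> p l) = (\<Sum>k\<in>UNIV. endo_comp A \<phi> \<kappa> k l p *\<^sub>R natural_frame A \<kappa> p k)"
  unfolding endo_comp_def
  by (rule tangent_expansion[OF \<kappa>]) (intro \<phi>_in natural_frame_in \<kappa>)

text \<open>Identifies the lower right block of the matrix. On frame vectors the first factor of the
  product becomes a component of \<phi>, while the other factors are Kronecker deltas.\<close>

lemma pull_dual_cotensor:
  "pull p (dual_cotensor A \<kappa> p R) = (\<Sum>K\<in>UNIV.
     (endo_comp A \<phi> \<kappa> (R first_slot) (K first_slot) p *
       (\<Prod>a\<in>UNIV - {first_slot}. if R a = K a then 1 else 0)) *\<^sub>R dual_cotensor A \<kappa> p K)"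
proof -
  have "cotensor_comp A \<kappa> p (pull p (dual_cotensor A \<kappa> p R)) K =
      endo_comp A \<phi> \<kappa> (R first_slot) (K first_slot) p *
       (\<Prod>a\<in>UNIV - {first_slot}. if R a = K a then 1 else 0)" for K
  proof -
    let ?vs = "\<lambda>a. natural_frame A \<kappa> p (K a)"
    have "cotensor_comp A \<kappa> p (pull p (dual_cotensor A \<kappa> p R)) K =
        (\<Prod>a\<in>UNIV. (?vs(first_slot := \<phi> p (?vs first_slot))) a \<kappa> $ R a)"
      using range_natural_frame[OF \<kappa>, of K] \<phi>_in[OF natural_frame_in[OF \<kappa>]]
      by (simp add: cotensor_comp_def pull_slot_def dual_cotensor_def range_fun_upd_subset del: fun_upd_apply)
    also have "\<dots> = \<phi> p (?vs first_slot) \<kappa> $ R first_slot *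
        (\<Prod>a\<in>UNIV - {first_slot}. ?vs a \<kappa> $ R a)"
      by (rule prod_fun_upd[where g = "\<lambda>b v. v \<kappa> $ R b"])
    finally show ?thesis
      by (simp add: endo_comp_def natural_frame_apply[OF \<kappa>] axis_def)
  qed
  with cotensor_expansion[OF \<kappa> pull_in[OF dual_cotensor_in], of \<kappa> R] show ?thesis
    by simp
qed

end

section \<open>Existence and uniqueness of the complete lift\<close>

lemma is_complete_lift_lift_endo:
  assumes \<kappa>0: "\<kappa>0 \<in> A" "p \<in> fst \<kappa>0"
  shows "is_complete_lift_at A \<phi> \<xi> p (lift_endo \<kappa>0 p)"
  unfolding is_complete_lift_at_def
proof (intro conjI ballI impI allI)
  show "lift_endo \<kappa>0 p \<in> extensional (tangent_space TB (p, \<xi> p))"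
    by (simp add: lift_endo_def)
  show "linear_endo (tangent_space TB (p, \<xi> p)) (lift_endo \<kappa>0 p)"
    by (rule lift_endo_linear[OF \<kappa>0])
  fix \<kappa> assume \<kappa>: "\<kappa> \<in> A" "p \<in> fst \<kappa>"
  note lin = linear_sum linear_scale
  note lin = lin[OF linear_section_lift[OF \<kappa>]] lin[OF linear_vertical_lift[OF \<kappa>]]
  \<comment> \<open>The map is built from \<open>\<kappa>0\<close>, but its matrix is prescribed in
    every chart around \<open>p\<close>. Both lifts are independent of the chart, so its formula may
    be read in \<open>\<kappa>\<close>.\<close>
  have eq: "lift_endo \<kappa>0 p (section_lift \<kappa> p w + vertical_lift \<kappa> p t) =
      section_lift \<kappa> p (\<phi> p w) + vertical_lift \<kappa> p (pull p t)"
    if "w \<in> tangent_space A p" "t \<in> cotensors A p" for w t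
    using that lift_endo_lift[OF \<kappa>0 that]
    by (simp add: section_lift_change[OF \<kappa>(1) \<kappa>0(1) \<kappa>(2) \<kappa>0(2)]
        vertical_lift_change[OF \<kappa>(1) \<kappa>0(1) \<kappa>(2) \<kappa>0(2)] \<phi>_in[OF \<kappa>] pull_in[OF \<kappa>])
  have lift_0: "section_lift \<kappa> p 0 = 0" "vertical_lift \<kappa> p 0 = 0"
    using linear_0[OF linear_section_lift[OF \<kappa>]] linear_0[OF linear_vertical_lift[OF \<kappa>]] .
  have \<phi>_0: "\<phi> p 0 = 0"
    using linear_endo_sum[OF \<phi>_endo[OF \<kappa>] subspace_tangent_space, of "{}"] by simp
  have pull_0: "pull p 0 = 0"
    by (rule linear_0[OF pull_slot_linear])
  \<comment> \<open>The case of a coordinate vector and the zero tensor; the lower left block of the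
    matrix vanishes because \<xi> is almost analytic.\<close>
  show "lift_endo \<kappa>0 p (B_frame A \<xi> \<kappa> p l) =
      (\<Sum>k\<in>UNIV. endo_comp A \<phi> \<kappa> k l p *\<^sub>R B_frame A \<xi> \<kappa> p k)
      - (\<Sum>K\<in>UNIV. tachibana A \<phi> \<xi> \<kappa> l K p *\<^sub>R C_frame A \<xi> \<kappa> p K)" for l
    using eq[OF natural_frame_in[OF \<kappa>] subspace_0[OF subspace_cotensors], of l]
    by (simp add: lift_0 pull_0 \<phi>_natural_frame[OF \<kappa>] lin B_frame_eq \<kappa> tachibana_zero)
  \<comment> \<open>The case of the zero vector and a dual basis tensor.\<close>
  show "lift_endo \<kappa>0 p (C_frame A \<xi> \<kappa> p R) =
      (\<Sum>K\<in>UNIV. (endo_comp A \<phi> \<kappa> (R first_slot) (K first_slot) p *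
         (\<Prod>a\<in>UNIV - {first_slot}. if R a = K a then 1 else 0)) *\<^sub>R C_frame A \<xi> \<kappa> p K)" for R
    using eq[OF subspace_0[OF subspace_tangent_space] dual_cotensor_in, of \<kappa> R]
    by (simp only: lift_0 \<phi>_0 pull_dual_cotensor[OF \<kappa>] lin C_frame_eq[OF \<kappa>] add_0_left)
qed

text \<open>Resolves the definite description: \<open>lift_endo\<close> satisfies the conditions in
  all charts, and those in the one chart \<open>\<kappa>\<close> already force any solution to agree
  with it.\<close>

lemma complete_lift_eq:
  assumes "\<kappa> \<in> A" "p \<in> fst \<kappa>"
  shows "complete_lift A \<phi> \<xi> (p, \<xi> p) = lift_endo \<kappa> p"
  unfolding complete_lift_def fst_conv
proof (rule the_equality)
  show L: "is_complete_lift_at A \<phi> \<xi> p (lift_endo \<kappa> p)"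
    by (rule is_complete_lift_lift_endo[OF assms])
  show "F = lift_endo \<kappa> p" if "is_complete_lift_at A \<phi> \<xi> p F" for F
    using that L assms unfolding is_complete_lift_at_def
    by (intro bundle_endo_eqI[OF assms]) simp_all
qed

end

theorem theorem1:
  fixes A :: "('m, real^'n::finite) chart set"
    and \<phi> :: "'m \<Rightarrow> ('m, real^'n) tangent \<Rightarrow> ('m, real^'n) tangent"
    and \<xi> :: "'m \<Rightarrow> ('m, 'n, 'q::{finite,linorder}) cotensor"
  assumes "smooth_manifold A"
    and "almost_complex_structure A \<phi>"
    and "almost_analytic A \<phi> \<xi>"
  shows "almost_complex_along (tensor_bundle A) (cross_section A \<xi>) (complete_lift A \<phi> \<xi>)"
proof -
  interpret analytic_section A \<xi> \<phi>
    using assms by unfold_locales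
      (auto simp: smooth_manifold_def almost_complex_structure_def almost_analytic_def)
  show ?thesis
    unfolding almost_complex_along_def
  proof
    fix u assume "u \<in> cross_section A \<xi>"
    \<comment> \<open>Any chart around the base point will do for expressing the complete lift
      through \<open>lift_endo\<close>.\<close>
    then obtain \<kappa> p where \<kappa>: "\<kappa> \<in> A" "p \<in> fst \<kappa>" and u: "u = (p, \<xi> p)"
      by (auto simp: cross_section_def points_def)
    show "linear_endo (tangent_space TB u) (complete_lift A \<phi> \<xi> u) \<and>
        (\<forall>v\<in>tangent_space TB u. complete_lift A \<phi> \<xi> u (complete_lift A \<phi> \<xi> u v) = - v)"
      unfolding u complete_lift_eq[OF \<kappa>]
      using lift_endo_linear[OF \<kappa>] lift_endo_lift_endo[OF \<kappa>] by blast
  qed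
qed

end
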